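(* Let $n\ge1$. For every padded composition $c$ of length $n$, $\mathfrak F_c(x_1,\dots,x_n;\mathbf 0)=\mathfrak F_c(x_1,\dots,x_n)$, the ordinary fundamental quasisymmetric polynomial. Furthermore, the set $$\{\mathfrak P_F(\mathbf x;\mathbf t): F\in\mathrm{Zigzag}_n\}=\{\mathfrak F_c(x_1,\dots,x_n;\mathbf t): c\text{ a padded composition of length } n\}$$ is a $\mathbb Z[\mathbf t]$-basis of $\mathrm{EQSym}_n$.
   Context: $\mathbf x=(x_1,x_2,\dots)$, $\mathbf t=(t_1,t_2,\dots)$. For $f\in\mathbb Z[\mathbf t][\mathbf x]$ let $R_i^-f=f(x_1,\dots,x_{i-1},t_i,x_i,\dots;\mathbf t)$, $R_i^+f=f(x_1,\dots,x_i,t_i,x_{i+1},\dots;\mathbf t)$, $E_if=(R_i^+f-R_i^-f)/(x_i-t_i)$. $\mathrm{EQSym}_n=\{f\in\mathbb Z[\mathbf t][x_1,\dots,x_n]: R_i^+f=R_i^-f\text{ for }1\le i<n\}$ (equivariantly quasisymmetric polynomials). Indexed forests: a binary plane tree is a rooted tree each of whose nodes is a leaf or an internal node with ordered left and right children. An indexed forest is a sequence $F=(T_1,T_2,\dots)$ of binary plane trees, all but finitely many being the one-node tree; leaves are identified with $\mathbb N$ left to right; $\emptyset$ is the forest with no internal nodes. An internal node is terminal if both children are leaves; $\rho_F(v)$ is the leaf reached from $v$ by repeatedly going to left children; $\mathrm{Qdes}(F)=\{\rho_F(v): v\text{ terminal}\}$; for $i\in\mathrm{Qdes}(F)$, $F/i$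 is obtained by deleting the terminal node with $\rho_F(v)=i$ (replacing it and its leaves by one leaf, relabeling). The code of $F$ is the sequence $(c_i)_{i\ge1}$ with $c_i=\#\{v\text{ internal}:\rho_F(v)=i\}$; this is a bijection from indexed forests to finitely supported sequences of nonnegative integers. $\mathrm{Zigzag}_n=\{F:\mathrm{Qdes}(F)\subseteq\{n\}\}$. Double forest polynomials $\mathfrak P_F(\mathbf x;\mathbf t)$: the unique family of homogeneous polynomials ($\deg x_i=\deg t_i=1$) with $\mathfrak P_F(\mathbf t;\mathbf t)=\delta_{F,\emptyset}$ and $E_i\mathfrak P_F=\mathfrak P_{F/i}(\mathbf x;\widehat{\mathbf t}_i)$ if $i\in\mathrm{Qdes}(F)$, $0$ otherwise, where $\widehat{\mathbf t}_i=(t_1,\dots,t_{i-1},t_{i+1},\dots)$. A padded composition of length $n$ is $c=(0^{n-\ell},a_1,\dots,a_\ell)$ with $\ell\ge0$ and all $a_i>0$; $F_c$ is the indexed forest whose code is $c$ followed by zeros, and the double fundamental quasisymmetric polynomial is $\mathfrak F_c(x_1,\dots,x_n;\mathbf t):=\mathfrak P_{F_c}(\mathbf x;\mathbf t)$. The ordinary fundamental quasisymmetric polynomial is $\mathfrak F_c(x_1,\dots,x_n)=\sum x_{i_1}\cdots x_{i_m}$, $m=a_1+\dots+a_\ell$, summed over $1\le i_1\le\dots\le i_m\le n$ with $i_j<i_{j+1}$ whenever $j\in\{a_1,a_1+a_2,\dots,a_1+\dots+a_{\ell-1}\}$. *)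

theory Defs
  imports Main "HOL-Library.Poly_Mapping"
begin

text \<open>Variables: X i stands for x_i, T i stands for t_i (indices i >= 1 are the meaningful ones).
  A polynomial is a finitely supported map from monomials (finitely supported exponent maps)
  to integer coefficients; this type is a commutative ring under convolution.\<close>

datatype var = X nat | T nat

type_synonym mono = "var \<Rightarrow>\<^sub>0 nat"
type_synonym mpoly = "mono \<Rightarrow>\<^sub>0 int"

definition Var :: "var \<Rightarrow> mpoly" where
  "Var v = Poly_Mapping.single (Poly_Mapping.single v 1) 1"

definition subst :: "(var \<Rightarrow> mpoly) \<Rightarrow> mpoly \<Rightarrow> mpoly" where
  "subst \<sigma> p = (\<Sum>m\<in>Poly_Mapping.keys p.
      of_int (Poly_Mapping.lookup p m) * (\<Prod>v\<in>Poly_Mapping.keys m. \<sigma> v ^ Poly_Mapping.lookup m v))"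

definition vars :: "mpoly \<Rightarrow> var set" where
  "vars p = (\<Union>m\<in>Poly_Mapping.keys p. Poly_Mapping.keys m)"

definition homogeneous :: "mpoly \<Rightarrow> bool" where
  "homogeneous p \<longleftrightarrow> (\<exists>d. \<forall>m\<in>Poly_Mapping.keys p. (\<Sum>v\<in>Poly_Mapping.keys m. Poly_Mapping.lookup m v) = d)"

definition pos_vars :: "mpoly \<Rightarrow> bool" where
  "pos_vars p \<longleftrightarrow> (\<forall>v\<in>vars p. case v of X i \<Rightarrow> i \<ge> 1 | T i \<Rightarrow> i \<ge> 1)"

definition Zt :: "mpoly set" where
  "Zt = {p. \<forall>v\<in>vars p. \<exists>i\<ge>1. v = T i}"

definition Zt_xn :: "nat \<Rightarrow> mpoly set" where
  "Zt_xn n = {p. \<forall>v\<in>vars p. (\<exists>i\<ge>1. v = T i) \<or> (\<exists>i. 1 \<le> i \<and> i \<le> n \<and> v = X i)}"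

definition Rminus :: "nat \<Rightarrow> mpoly \<Rightarrow> mpoly" where
  "Rminus i = subst (\<lambda>v. case v of
       X j \<Rightarrow> (if j < i then Var (X j) else if j = i then Var (T i) else Var (X (j - 1)))
     | T j \<Rightarrow> Var (T j))"

definition Rplus :: "nat \<Rightarrow> mpoly \<Rightarrow> mpoly" where
  "Rplus i = subst (\<lambda>v. case v of
       X j \<Rightarrow> (if j \<le> i then Var (X j) else if j = i + 1 then Var (T i) else Var (X (j - 1)))
     | T j \<Rightarrow> Var (T j))"

text \<open>E_i f = (R_i^+ f - R_i^- f) / (x_i - t_i) (the division is exact).\<close>
definition Eop :: "nat \<Rightarrow> mpoly \<Rightarrow> mpoly" where
  "Eop i f = (THE g. (Var (X i) - Var (T i)) * g = Rplus i f - Rminus i f)"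

definition that :: "nat \<Rightarrow> mpoly \<Rightarrow> mpoly" where
  "that i = subst (\<lambda>v. case v of X j \<Rightarrow> Var (X j)
                               | T j \<Rightarrow> (if j < i then Var (T j) else Var (T (j + 1))))"

definition eval_tt :: "mpoly \<Rightarrow> mpoly" where
  "eval_tt = subst (\<lambda>v. case v of X j \<Rightarrow> Var (T j) | T j \<Rightarrow> Var (T j))"

definition eval_t0 :: "mpoly \<Rightarrow> mpoly" where
  "eval_t0 = subst (\<lambda>v. case v of X j \<Rightarrow> Var (X j) | T j \<Rightarrow> 0)"

definition EQSym :: "nat \<Rightarrow> mpoly set" where
  "EQSym n = {f \<in> Zt_xn n. \<forall>i. 1 \<le> i \<and> i < n \<longrightarrow> Rplus i f = Rminus i f}"

datatype tree = Leaf | Node tree tree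

fun leaves :: "tree \<Rightarrow> nat" where
  "leaves Leaf = 1"
| "leaves (Node l r) = leaves l + leaves r"

text \<open>An indexed forest is a sequence of binary plane trees (indexed by 0,1,2,...),
  all but finitely many being the one-node tree Leaf. Leaves are numbered 1,2,3,...
  from left to right.\<close>
type_synonym forest = "nat \<Rightarrow> tree"

definition is_forest :: "forest \<Rightarrow> bool" where
  "is_forest F \<longleftrightarrow> finite {k. F k \<noteq> Leaf}"

definition empty_forest :: forest where
  "empty_forest = (\<lambda>_. Leaf)"

text \<open>label of the leftmost leaf of tree k, i.e. of the first leaf of that tree\<close>
definition base :: "forest \<Rightarrow> nat \<Rightarrow> nat" where
  "base F k = (\<Sum>j<k. leaves (F j)) + 1"

text \<open>In a subtree whose leftmost leaf has label a, rho of its root is a.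
  tqdes t a: the values rho(v) for terminal nodes v of t.\<close>
fun tqdes :: "tree \<Rightarrow> nat \<Rightarrow> nat set" where
  "tqdes Leaf a = {}"
| "tqdes (Node Leaf Leaf) a = {a}"
| "tqdes (Node l r) a = tqdes l a \<union> tqdes r (a + leaves l)"

definition Qdes :: "forest \<Rightarrow> nat set" where
  "Qdes F = (\<Union>k. tqdes (F k) (base F k))"

fun tcode :: "tree \<Rightarrow> nat \<Rightarrow> nat \<Rightarrow> nat" where
  "tcode Leaf a i = 0"
| "tcode (Node l r) a i = (if i = a then 1 else 0) + tcode l a i + tcode r (a + leaves l) i"

text \<open>code F i = c_i (for i >= 1); tree k only has leaves with labels > k.\<close>
definition code :: "forest \<Rightarrow> nat \<Rightarrow> nat" where
  "code F i = (\<Sum>k<i. tcode (F k) (base F k) i)"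

fun tdel :: "tree \<Rightarrow> nat \<Rightarrow> nat \<Rightarrow> tree" where
  "tdel Leaf a i = Leaf"
| "tdel (Node Leaf Leaf) a i = (if a = i then Leaf else Node Leaf Leaf)"
| "tdel (Node l r) a i = Node (tdel l a i) (tdel r (a + leaves l) i)"

definition fdel :: "forest \<Rightarrow> nat \<Rightarrow> forest" where
  "fdel F i = (\<lambda>k. tdel (F k) (base F k) i)"

definition Zigzag :: "nat \<Rightarrow> forest set" where
  "Zigzag n = {F. is_forest F \<and> Qdes F \<subseteq> {n}}"

definition dfp_char :: "(forest \<Rightarrow> mpoly) \<Rightarrow> bool" where
  "dfp_char P \<longleftrightarrow>
     (\<forall>F. is_forest F \<longrightarrow>
        homogeneous (P F) \<and> pos_vars (P F) \<and>
        eval_tt (P F) = (if F = empty_forest then 1 else 0) \<and>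
        (\<forall>i\<ge>1. Eop i (P F) = (if i \<in> Qdes F then that i (P (fdel F i)) else 0)))"

text \<open>The unique such family (values on non-forests normalised to 0).\<close>
definition dfp :: "forest \<Rightarrow> mpoly" where
  "dfp = (THE P. dfp_char P \<and> (\<forall>F. \<not> is_forest F \<longrightarrow> P F = 0))"

definition padded_comp :: "nat \<Rightarrow> nat list \<Rightarrow> bool" where
  "padded_comp n c \<longleftrightarrow> length c = n \<and> (\<forall>i j. i < j \<and> j < n \<and> 0 < c ! i \<longrightarrow> 0 < c ! j)"

definition forest_of_comp :: "nat list \<Rightarrow> forest" where
  "forest_of_comp c = (THE F. is_forest F \<and>
      (\<forall>i\<ge>1. code F i = (if i \<le> length c then c ! (i - 1) else 0)))"

definition dfqs :: "nat list \<Rightarrow> mpoly" where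
  "dfqs c = dfp (forest_of_comp c)"

definition fqs :: "nat \<Rightarrow> nat list \<Rightarrow> mpoly" where
  "fqs n c = (let a = filter (\<lambda>k. 0 < k) c;
                  m = sum_list a;
                  D = {sum_list (take k a) | k. 1 \<le> k \<and> k < length a}
              in \<Sum>s\<in>{s. length s = m \<and> sorted s \<and> set s \<subseteq> {1..n} \<and>
                          (\<forall>j\<in>D. s ! (j - 1) < s ! j)}.
                   (\<Prod>j<m. Var (X (s ! j))))"

definition Zt_basis :: "mpoly set \<Rightarrow> mpoly set \<Rightarrow> bool" where
  "Zt_basis B M \<longleftrightarrow> B \<subseteq> M \<and>
     (\<forall>f\<in>M. \<exists>!a. finite {b. a b \<noteq> 0} \<and> {b. a b \<noteq> 0} \<subseteq> B \<and> (\<forall>b. a b \<in> Zt) \<and>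
                  f = (\<Sum>b\<in>{b. a b \<noteq> 0}. a b * b))"

end

theory Submission
  imports Defs
begin

text \<open>
  The operators \<open>E\<^sub>i\<close> satisfy \<open>E\<^sub>j E\<^sub>i = E\<^bsub>i-1\<^esub> E\<^sub>j\<close> for \<open>i > j + 1\<close> (with the parameter
  \<open>t\<^sub>i\<close> kept), and a family \<open>(g\<^sub>i)\<close> obeying the corresponding relations can be integrated to
  some \<open>f\<close> with \<open>E\<^sub>i f = g\<^sub>i\<close> by peeling off the last variable. On codes, \<open>F/i\<close> lowers
  \<open>c\<^sub>i\<close> and deletes \<open>c\<^bsub>i+1\<^esub> = 0\<close>, so deletions of forests obey the same relations; this gives
  existence of the double forest polynomials. A polynomial killed by all \<open>E\<^sub>i\<close> lies in
  \<open>\<int>[t]\<close>, which gives uniqueness. Applying successive \<open>E\<^sub>i\<close> to a linear relation isolates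
  each coefficient, so the double forest polynomials are independent; the peeling argument shows
  that they span. In an expansion of \<open>f\<close>, \<open>E\<^sub>i f = 0\<close> forces the coefficients of all
  \<open>F\<close> with \<open>i \<in> Qdes F\<close> to vanish, which for all \<open>i \<noteq> n\<close> leaves exactly the zigzag forests.
\<close>

subsection \<open>Polynomial substitution\<close>

text \<open>The obstacle is that F/i comes with the alphabet from which t_i is removed, so the
  family at one fixed alphabet is not closed under the E_i. Statements are therefore made for an
  arbitrary sequence s of linear forms substituted for t, with E_i taken at the parameter s_i.
  Applying E_i then replaces s by the sequence that skips s_i, and inductions run over all s at
  once. Coefficients stay in \<int>[t] whatever s is, and the E_i are linear over them because
  insertions leave the t-variables alone. The zero sequence is unchanged by skipping, so at t = 0
  the recursion involves a single alphabet. The relations omit i = j + 1. This matches the forests: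
  j and j + 1 are never both in Qdes F, since the first needs c_{j+1} = 0 and the second c_{j+1} >
  0. Integration determines a polynomial only up to \<int>[t]; the value at x = t fixes this
  constant.\<close>

text \<open>With any linear order on the variables, the library makes \<open>mpoly\<close> an integral domain,
  so that the quotient defining \<open>E\<^sub>i\<close> is unique.\<close>
instantiation var :: linorder
begin

definition less_eq_var :: "var \<Rightarrow> var \<Rightarrow> bool" where
  "less_eq_var v w \<longleftrightarrow> (case v of
     X i \<Rightarrow> (case w of X j \<Rightarrow> i \<le> j | T j \<Rightarrow> True)
   | T i \<Rightarrow> (case w of X j \<Rightarrow> False | T j \<Rightarrow> i \<le> j))"

definition less_var :: "var \<Rightarrow> var \<Rightarrow> bool" where
  "less_var v w \<longleftrightarrow> v \<le> w \<and> \<not> w \<le> v"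

instance
  by standard (auto simp: less_eq_var_def less_var_def split: var.splits)

end

abbreviation "keys \<equiv> Poly_Mapping.keys"
abbreviation "lookup \<equiv> Poly_Mapping.lookup"
abbreviation "single \<equiv> Poly_Mapping.single"

lemma single_0_int: "single 0 k = (of_int k :: mpoly)"
  by (metis single_of_int of_int_eq_id id_apply)

definition monom_at :: "(var \<Rightarrow> mpoly) \<Rightarrow> mono \<Rightarrow> mpoly" where
  "monom_at \<sigma> m = (\<Prod>v\<in>keys m. \<sigma> v ^ lookup m v)"

lemma monom_at_superset:
  assumes "finite A" "keys m \<subseteq> A"
  shows "monom_at \<sigma> m = (\<Prod>v\<in>A. \<sigma> v ^ lookup m v)"
  unfolding monom_at_def
  by (rule prod.mono_neutral_left) (use assms in \<open>auto simp: in_keys_iff\<close>)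

lemma monom_at_zero [simp]: "monom_at \<sigma> 0 = 1"
  by (simp add: monom_at_def)

lemma monom_at_single [simp]: "monom_at \<sigma> (single v k) = \<sigma> v ^ k"
  by (simp add: monom_at_def)

lemma monom_at_add: "monom_at \<sigma> (m + m') = monom_at \<sigma> m * monom_at \<sigma> m'"
proof -
  let ?A = "keys m \<union> keys m'"
  have "monom_at \<sigma> (m + m') = (\<Prod>v\<in>?A. \<sigma> v ^ lookup (m + m') v)"
    by (rule monom_at_superset) (auto simp: keys_add)
  also have "\<dots> = (\<Prod>v\<in>?A. \<sigma> v ^ lookup m v) * (\<Prod>v\<in>?A. \<sigma> v ^ lookup m' v)"
    by (simp add: lookup_add power_add prod.distrib)
  also have "\<dots> = monom_at \<sigma> m * monom_at \<sigma> m'"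
    by (simp add: monom_at_superset[of ?A])
  finally show ?thesis .
qed

text \<open>Keys change under addition; any finite superset of them serves as an index set shared by
  several polynomials.\<close>

lemma subst_superset:
  assumes "finite A" "keys p \<subseteq> A"
  shows "subst \<sigma> p = (\<Sum>m\<in>A. of_int (lookup p m) * monom_at \<sigma> m)"
  unfolding subst_def monom_at_def
  by (rule sum.mono_neutral_left) (use assms in \<open>auto simp: in_keys_iff\<close>)

lemma subst_add [simp]: "subst \<sigma> (p + q) = subst \<sigma> p + subst \<sigma> q"
proof -
  let ?A = "keys p \<union> keys q"
  have "keys (p + q) \<subseteq> ?A" by (rule keys_add)
  then show ?thesis
    by (simp add: subst_superset[of ?A] lookup_add algebra_simps sum.distrib)
qed

lemma subst_zero [simp]: "subst \<sigma> 0 = 0"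
  by (simp add: subst_def)

lemma subst_uminus [simp]: "subst \<sigma> (- p) = - subst \<sigma> p"
  using subst_add[of \<sigma> p "- p"] by (simp add: eq_neg_iff_add_eq_0 add.commute)

lemma subst_diff [simp]: "subst \<sigma> (p - q) = subst \<sigma> p - subst \<sigma> q"
  using subst_add[of \<sigma> p "- q"] by simp

lemma subst_sum [simp]: "subst \<sigma> (\<Sum>x\<in>A. f x) = (\<Sum>x\<in>A. subst \<sigma> (f x))"
  by (induction A rule: infinite_finite_induct) auto

lemma subst_single: "subst \<sigma> (single m c) = of_int c * monom_at \<sigma> m"
  by (subst subst_superset[of "{m}"]) auto

lemma poly_sum_single: "p = (\<Sum>m\<in>keys p. single m (lookup p m))"
  for p :: "'a \<Rightarrow>\<^sub>0 'b::comm_monoid_add"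
proof (rule poly_mapping_eqI)
  fix k
  have "lookup (\<Sum>m\<in>keys p. single m (lookup p m)) k
      = (\<Sum>m\<in>keys p. if m = k then lookup p m else 0)"
    unfolding lookup_sum by (intro sum.cong) (auto simp: lookup_single when_def)
  then show "lookup p k = lookup (\<Sum>m\<in>keys p. single m (lookup p m)) k"
    by (simp add: in_keys_iff)
qed

text \<open>Both factors are expanded into monomials, where the claim is
  \<open>monom_at_add\<close>; distributivity does the rest.\<close>

lemma subst_mult [simp]: "subst \<sigma> (p * q) = subst \<sigma> p * subst \<sigma> q"
proof -
  have sing: "subst \<sigma> (single m c * single m' c')
      = subst \<sigma> (single m c) * subst \<sigma> (single m' c')" for m c m' c'
    by (simp add: mult_single subst_single monom_at_add algebra_simps)
  have "subst \<sigma> (p * q) = subst \<sigma> ((\<Sum>m\<in>keys p. single m (lookup p m))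
      * (\<Sum>m\<in>keys q. single m (lookup q m)))"
    by (simp flip: poly_sum_single)
  also have "\<dots> = subst \<sigma> (\<Sum>m\<in>keys p. single m (lookup p m))
      * subst \<sigma> (\<Sum>m\<in>keys q. single m (lookup q m))"
    by (simp add: sum_product sing)
  also have "\<dots> = subst \<sigma> p * subst \<sigma> q"
    by (simp flip: poly_sum_single)
  finally show ?thesis .
qed

lemma subst_one [simp]: "subst \<sigma> 1 = 1"
  using subst_single[of \<sigma> 0 1] by simp

lemma subst_of_int [simp]: "subst \<sigma> (of_int k) = of_int k"
  using subst_single[of \<sigma> 0 k] by (simp add: single_0_int)

lemma subst_power [simp]: "subst \<sigma> (p ^ k) = subst \<sigma> p ^ k"
  by (induction k) auto

lemma subst_prod [simp]: "subst \<sigma> (\<Prod>x\<in>A. f x) = (\<Prod>x\<in>A. subst \<sigma> (f x))"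
  by (induction A rule: infinite_finite_induct) auto

lemma subst_Var [simp]: "subst \<sigma> (Var v) = \<sigma> v"
  by (simp add: Var_def subst_single)

lemma subst_subst: "subst \<sigma> (subst \<tau> p) = subst (\<lambda>v. subst \<sigma> (\<tau> v)) p"
  by (simp add: subst_superset[of "keys p" p] monom_at_def)

text \<open>Rebuilding a monomial from its variables identifies \<open>Var\<close> as the identity
  substitution.\<close>

lemma single_eq_monom_at: "single m c = of_int c * monom_at Var m"
proof -
  have Var_power: "Var v ^ k = single (single v k) 1" for v k
  proof (induction k)
    case (Suc k)
    then show ?case
      by (simp add: Var_def mult_single flip: single_add)
  qed simp
  have "(\<Prod>v\<in>A. single (f v) (1::int)) = single (\<Sum>v\<in>A. f v) 1"
    if "finite A" for A and f :: "var \<Rightarrow> mono"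
    using that by (induction A rule: finite_induct) (auto simp: mult_single)
  then have "monom_at Var m = single m 1"
    by (simp add: monom_at_def Var_power flip: poly_sum_single)
  then show ?thesis
    by (simp add: mult_single flip: single_0_int)
qed

lemma subst_Var_id [simp]: "subst Var p = p"
proof -
  have "subst Var p = (\<Sum>m\<in>keys p. single m (lookup p m))"
    by (simp add: subst_superset[of "keys p"] single_eq_monom_at)
  then show ?thesis
    by (simp flip: poly_sum_single)
qed

lemma subst_cong:
  assumes "\<And>v. v \<in> vars p \<Longrightarrow> \<sigma> v = \<tau> v"
  shows "subst \<sigma> p = subst \<tau> p"
  unfolding subst_def
  by (intro sum.cong refl arg_cong2[where f="(*)"] prod.cong arg_cong2[where f="(^)"] assms)
     (auto simp: vars_def)

lemma subst_id_on:
  assumes "\<And>v. v \<in> vars p \<Longrightarrow> \<sigma> v = Var v"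
  shows "subst \<sigma> p = p"
  using subst_cong[of p \<sigma> Var] assms by simp

subsection \<open>Occurring variables\<close>

lemma vars_zero [simp]: "vars 0 = {}"
  by (simp add: vars_def)

lemma vars_of_int [simp]: "vars (of_int k) = {}"
  by (simp add: vars_def flip: single_0_int)

lemma vars_one [simp]: "vars 1 = {}"
  by (simp add: vars_def)

lemma vars_Var [simp]: "vars (Var v) = {v}"
  by (simp add: vars_def Var_def)

lemma vars_uminus [simp]: "vars (- p) = vars p"
  by (simp add: vars_def)

lemma vars_add: "vars (p + q) \<subseteq> vars p \<union> vars q"
  using keys_add[of p q] by (auto simp: vars_def)

lemma vars_diff: "vars (p - q) \<subseteq> vars p \<union> vars q"
  using vars_add[of p "- q"] by simp

lemma vars_mult: "vars (p * q) \<subseteq> vars p \<union> vars q"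
proof
  fix v assume "v \<in> vars (p * q)"
  then obtain m where m: "m \<in> keys (p * q)" "v \<in> keys m"
    by (auto simp: vars_def)
  from m(1) obtain a b where "m = a + b" "a \<in> keys p" "b \<in> keys q"
    using keys_mult[of p q] by auto
  with m(2) show "v \<in> vars p \<union> vars q"
    using keys_add[of a b] by (auto simp: vars_def)
qed

lemma vars_sum: "vars (\<Sum>x\<in>A. f x) \<subseteq> (\<Union>x\<in>A. vars (f x))"
proof (induction A rule: infinite_finite_induct)
  case (insert x A)
  then show ?case using vars_add[of "f x" "sum f A"] by auto
qed auto

lemma vars_prod: "vars (\<Prod>x\<in>A. f x) \<subseteq> (\<Union>x\<in>A. vars (f x))"
proof (induction A rule: infinite_finite_induct)
  case (insert x A)
  then show ?case using vars_mult[of "f x" "prod f A"] by auto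
qed auto

lemma vars_power: "vars (p ^ k) \<subseteq> vars p"
proof (induction k)
  case (Suc k)
  then show ?case using vars_mult[of p "p ^ k"] by auto
qed auto

lemma vars_subst: "vars (subst \<sigma> p) \<subseteq> (\<Union>w\<in>vars p. vars (\<sigma> w))"
proof
  fix v assume "v \<in> vars (subst \<sigma> p)"
  then obtain m where m: "m \<in> keys p"
    and "v \<in> vars (of_int (lookup p m) * (\<Prod>v\<in>keys m. \<sigma> v ^ lookup m v))"
    unfolding subst_def using vars_sum by blast
  then have "v \<in> vars (\<Prod>v\<in>keys m. \<sigma> v ^ lookup m v)"
    using vars_mult[of "of_int (lookup p m)"] by fastforce
  then obtain w where "w \<in> keys m" "v \<in> vars (\<sigma> w ^ lookup m w)"
    using vars_prod by blast
  then show "v \<in> (\<Union>w\<in>vars p. vars (\<sigma> w))"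
    using m vars_power by (fastforce simp: vars_def)
qed

lemma finite_vars: "finite (vars p)"
  by (simp add: vars_def)

section \<open>Subrings cut out by a set of allowed variables\<close>

definition poly_ring :: "var set \<Rightarrow> mpoly set" where
  "poly_ring V = {p. vars p \<subseteq> V}"

lemma poly_ring_zero [simp, intro]: "0 \<in> poly_ring V"
  and poly_ring_one [simp, intro]: "1 \<in> poly_ring V"
  and poly_ring_of_int [simp, intro]: "of_int k \<in> poly_ring V"
  and poly_ring_Var [simp]: "Var v \<in> poly_ring V \<longleftrightarrow> v \<in> V"
  and poly_ring_uminus [simp, intro]: "p \<in> poly_ring V \<Longrightarrow> - p \<in> poly_ring V"
  by (auto simp: poly_ring_def)

lemma poly_ring_add [simp, intro]: "p \<in> poly_ring V \<Longrightarrow> q \<in> poly_ring V \<Longrightarrow> p + q \<in> poly_ring V"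
  and poly_ring_diff [simp, intro]: "p \<in> poly_ring V \<Longrightarrow> q \<in> poly_ring V \<Longrightarrow> p - q \<in> poly_ring V"
  and poly_ring_mult [simp, intro]: "p \<in> poly_ring V \<Longrightarrow> q \<in> poly_ring V \<Longrightarrow> p * q \<in> poly_ring V"
  using vars_add[of p q] vars_diff[of p q] vars_mult[of p q] by (auto simp: poly_ring_def)

lemma poly_ring_sum [intro]: "(\<And>x. x \<in> A \<Longrightarrow> f x \<in> poly_ring V) \<Longrightarrow> (\<Sum>x\<in>A. f x) \<in> poly_ring V"
  by (induction A rule: infinite_finite_induct) auto

lemma poly_ring_subst:
  assumes "p \<in> poly_ring V" "\<And>v. v \<in> V \<Longrightarrow> \<sigma> v \<in> poly_ring W"
  shows "subst \<sigma> p \<in> poly_ring W"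
  using vars_subst[of \<sigma> p] assms by (fastforce simp: poly_ring_def)

lemma poly_ring_mono: "p \<in> poly_ring V \<Longrightarrow> V \<subseteq> W \<Longrightarrow> p \<in> poly_ring W"
  by (auto simp: poly_ring_def)

text \<open>The datatype also contains \<open>X 0\<close> and \<open>T 0\<close>; they must be kept
  out because parameter sequences are constrained only from index 1 on.\<close>

definition pos_set :: "var set" where
  "pos_set = {X i | i. i \<ge> 1} \<union> {T i | i. i \<ge> 1}"

lemma Zt_eq: "Zt = poly_ring {T i | i. i \<ge> 1}"
  by (auto simp: Zt_def poly_ring_def)

lemma Zt_xn_eq: "Zt_xn n = poly_ring ({X i | i. 1 \<le> i \<and> i \<le> n} \<union> {T i | i. i \<ge> 1})"
  by (auto simp: Zt_xn_def poly_ring_def; blast)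

lemma pos_vars_eq: "pos_vars p \<longleftrightarrow> p \<in> poly_ring pos_set"
  by (auto simp: pos_vars_def poly_ring_def pos_set_def split: var.splits)
     (metis Un_iff mem_Collect_eq subsetD var.exhaust var.inject var.distinct)+

subsection \<open>Homogeneous polynomials\<close>

definition mdeg :: "mono \<Rightarrow> nat" where
  "mdeg m = (\<Sum>v\<in>keys m. lookup m v)"

text \<open>The degree, hidden by an existential in \<open>homogeneous\<close>, is made explicit for
  inductions on it.\<close>

definition homog :: "nat \<Rightarrow> mpoly set" where
  "homog d = {p. \<forall>m\<in>keys p. mdeg m = d}"

lemma mdeg_superset:
  assumes "finite A" "keys m \<subseteq> A"
  shows "mdeg m = (\<Sum>v\<in>A. lookup m v)"
  unfolding mdeg_def
  by (rule sum.mono_neutral_left) (use assms in \<open>auto simp: in_keys_iff\<close>)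

lemma mdeg_add: "mdeg (m + m') = mdeg m + mdeg m'"
proof -
  let ?A = "keys m \<union> keys m'"
  have "keys (m + m') \<subseteq> ?A" by (rule keys_add)
  then show ?thesis
    by (simp add: mdeg_superset[of ?A] lookup_add sum.distrib)
qed

lemma mdeg_single [simp]: "mdeg (single v k) = k"
  by (simp add: mdeg_def)

lemma mdeg_eq_0_iff: "mdeg m = 0 \<longleftrightarrow> m = 0"
  by (auto simp: mdeg_def in_keys_iff intro!: poly_mapping_eqI)

lemma homogeneous_iff: "homogeneous p \<longleftrightarrow> (\<exists>d. p \<in> homog d)"
  by (auto simp: homogeneous_def homog_def mdeg_def)

lemma homog_zero [simp]: "0 \<in> homog d"
  by (simp add: homog_def)

lemma homog_uminus: "p \<in> homog d \<Longrightarrow> - p \<in> homog d"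
  by (simp add: homog_def)

lemma homog_add: "p \<in> homog d \<Longrightarrow> q \<in> homog d \<Longrightarrow> p + q \<in> homog d"
  using keys_add[of p q] by (auto simp: homog_def)

lemma homog_diff: "p \<in> homog d \<Longrightarrow> q \<in> homog d \<Longrightarrow> p - q \<in> homog d"
  using homog_add[of p d "- q"] by (simp add: homog_uminus)

lemma homog_mult: "p \<in> homog d \<Longrightarrow> q \<in> homog e \<Longrightarrow> p * q \<in> homog (d + e)"
  using keys_mult[of p q] by (fastforce simp: homog_def mdeg_add)

lemma homog_sum: "(\<And>x. x \<in> A \<Longrightarrow> f x \<in> homog d) \<Longrightarrow> (\<Sum>x\<in>A. f x) \<in> homog d"
  by (induction A rule: infinite_finite_induct) (auto simp: homog_add)

lemma homog_single: "single m c \<in> homog (mdeg m)"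
  by (simp add: homog_def)

lemma homog_Var [simp]: "Var v \<in> homog (Suc 0)"
  by (simp add: homog_def Var_def)

lemma homog_of_int [simp]: "of_int k \<in> homog 0"
  using homog_single[of 0 k] by (simp add: mdeg_eq_0_iff[THEN iffD2] single_0_int)

lemma homog_one [simp]: "1 \<in> homog 0"
  using homog_of_int[of 1] by simp

lemma homog_power: "p \<in> homog d \<Longrightarrow> p ^ k \<in> homog (k * d)"
  by (induction k) (auto dest: homog_mult)

lemma homog_prod:
  "(\<And>x. x \<in> A \<Longrightarrow> f x \<in> homog (d x)) \<Longrightarrow> (\<Prod>x\<in>A. f x) \<in> homog (\<Sum>x\<in>A. d x)"
  by (induction A rule: infinite_finite_induct) (auto simp: homog_mult)

lemma homog_0E:
  assumes "p \<in> homog 0"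
  obtains k where "p = of_int k"
proof
  have "keys p \<subseteq> {0}"
    using assms by (auto simp: homog_def mdeg_eq_0_iff)
  then have "p = single 0 (lookup p 0)"
    by (intro poly_mapping_eqI) (auto simp: lookup_single when_def in_keys_iff)
  then show "p = of_int (lookup p 0)"
    by (simp add: single_0_int)
qed

lemma homog_subst:
  assumes "p \<in> homog d" "\<And>v. \<sigma> v \<in> homog (Suc 0)"
  shows "subst \<sigma> p \<in> homog d"
  unfolding subst_def
proof (rule homog_sum)
  fix m assume "m \<in> keys p"
  then have d: "d = (\<Sum>v\<in>keys m. lookup m v)"
    using assms(1) by (auto simp: homog_def mdeg_def)
  have "(\<Prod>v\<in>keys m. \<sigma> v ^ lookup m v) \<in> homog (\<Sum>v\<in>keys m. lookup m v)"
    by (rule homog_prod) (use homog_power[OF assms(2)] in simp)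
  then show "of_int (lookup p m) * (\<Prod>v\<in>keys m. \<sigma> v ^ lookup m v) \<in> homog d"
    using homog_mult[OF homog_of_int] d by fastforce
qed

text \<open>Reduces spanning to homogeneous polynomials, for which induction on the degree is
  available.\<close>

lemma poly_ring_monomial_sum:
  assumes "p \<in> poly_ring V"
  obtains f where "p = (\<Sum>m\<in>keys p. f m)"
    "\<And>m. m \<in> keys p \<Longrightarrow> f m \<in> poly_ring V" "\<And>m. f m \<in> homog (mdeg m)"
proof
  show "p = (\<Sum>m\<in>keys p. single m (lookup p m))"
    by (rule poly_sum_single)
  show "single m (lookup p m) \<in> poly_ring V" if "m \<in> keys p" for m
    using that assms by (auto simp: poly_ring_def vars_def)
qed (rule homog_single)

subsection \<open>Divided differences with an arbitrary parameter\<close>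

abbreviation Pos :: "mpoly set" where "Pos \<equiv> poly_ring pos_set"

text \<open>Lying in \<int>[t] makes a parameter invariant under insertions; degree one makes
  insertions preserve degree. The value 0 qualifies because it lies in every
  \<open>homog d\<close>.\<close>

definition params :: "mpoly set" where "params = Zt \<inter> homog (Suc 0)"

text \<open>The parameter of each operator is a linear form in the \<open>t\<close>-variables rather than
  just \<open>t\<^sub>i\<close>: the values \<open>t\<^sub>j\<close> occur through the hatted alphabets, and the value 0
  through the specialisation at \<open>t = 0\<close>.\<close>
definition ins :: "nat \<Rightarrow> mpoly \<Rightarrow> mpoly \<Rightarrow> mpoly" where
  "ins k s = subst (\<lambda>v. case v of
       X j \<Rightarrow> (if j < k then Var (X j) else if j = k then s else Var (X (j - 1)))
     | T j \<Rightarrow> Var (T j))"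

definition E :: "nat \<Rightarrow> mpoly \<Rightarrow> mpoly \<Rightarrow> mpoly" where
  "E i s f = (THE g. (Var (X i) - s) * g = ins (Suc i) s f - ins i s f)"

lemma Rminus_ins: "Rminus i = ins i (Var (T i))"
  by (simp add: Rminus_def ins_def)

text \<open>The two operators insert the same t_i and differ only in the position, i + 1 instead of
  i.\<close>

lemma Rplus_ins: "Rplus i = ins (Suc i) (Var (T i))"
  unfolding Rplus_def ins_def
  by (intro arg_cong[where f=subst] ext) (auto split: var.splits)

lemma Eop_E: "Eop i f = E i (Var (T i)) f"
  by (simp add: Eop_def E_def Rminus_ins Rplus_ins)

lemma Zt_xn_0: "Zt_xn 0 = Zt"
  by (auto simp: Zt_xn_def Zt_def)

lemma Zt_xn_mono: "p \<in> Zt_xn m \<Longrightarrow> m \<le> n \<Longrightarrow> p \<in> Zt_xn n"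
  by (auto simp: Zt_xn_def intro: order_trans)

lemma Zt_xn_Pos: "p \<in> Zt_xn n \<Longrightarrow> p \<in> Pos"
  unfolding Zt_xn_eq pos_set_def by (erule poly_ring_mono) auto

lemma Zt_Zt_xn: "p \<in> Zt \<Longrightarrow> p \<in> Zt_xn n"
  unfolding Zt_xn_eq Zt_eq by (erule poly_ring_mono) auto

lemma Zt_Pos: "p \<in> Zt \<Longrightarrow> p \<in> Pos"
  by (blast intro: Zt_xn_Pos Zt_Zt_xn)

lemma Pos_Zt_xn:
  assumes "p \<in> Pos"
  obtains n where "p \<in> Zt_xn n"
proof
  let ?I = "{i. X i \<in> vars p}"
  have "inj_on X ?I" by (auto simp: inj_on_def)
  moreover have "finite (X ` ?I)" by (rule finite_subset[OF _ finite_vars[of p]]) auto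
  ultimately have "finite ?I" by (blast dest: finite_imageD)
  then have "i \<le> Max ?I" if "X i \<in> vars p" for i using that by auto
  then show "p \<in> Zt_xn (Max ?I)"
    using assms unfolding Zt_xn_eq poly_ring_def pos_set_def by blast
qed

lemma params_Zt: "s \<in> params \<Longrightarrow> s \<in> Zt"
  and params_homog: "s \<in> params \<Longrightarrow> s \<in> homog (Suc 0)"
  and params_Pos: "s \<in> params \<Longrightarrow> s \<in> Pos"
  by (auto simp: params_def Zt_Pos)

lemma params_T [simp]: "i \<ge> 1 \<Longrightarrow> Var (T i) \<in> params"
  by (auto simp: params_def Zt_eq)

lemma params_0 [simp]: "0 \<in> params"
  by (auto simp: params_def Zt_eq)

lemma ins_add [simp]: "ins k s (p + q) = ins k s p + ins k s q"
  and ins_diff [simp]: "ins k s (p - q) = ins k s p - ins k s q"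
  and ins_mult [simp]: "ins k s (p * q) = ins k s p * ins k s q"
  and ins_sum [simp]: "ins k s (\<Sum>x\<in>A. f x) = (\<Sum>x\<in>A. ins k s (f x))"
  and ins_zero [simp]: "ins k s 0 = 0"
  by (simp_all add: ins_def)

lemma ins_X [simp]: "ins k s (Var (X j)) =
    (if j < k then Var (X j) else if j = k then s else Var (X (j - 1)))"
  and ins_T [simp]: "ins k s (Var (T j)) = Var (T j)"
  by (simp_all add: ins_def)

lemma ins_low: "p \<in> Zt_xn n \<Longrightarrow> n < k \<Longrightarrow> ins k s p = p"
  unfolding ins_def by (rule subst_id_on) (auto simp: Zt_xn_def)

lemma ins_Zt [simp]: "p \<in> Zt \<Longrightarrow> ins k s p = p"
  unfolding ins_def by (rule subst_id_on) (auto simp: Zt_def)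

lemma ins_params [simp]: "p \<in> params \<Longrightarrow> ins k s p = p"
  by (simp add: params_Zt)

lemma ins_Pos: "p \<in> Pos \<Longrightarrow> k \<ge> 1 \<Longrightarrow> s \<in> params \<Longrightarrow> ins k s p \<in> Pos"
  unfolding ins_def
  by (erule poly_ring_subst)
     (auto simp: params_Pos split: var.split, auto simp: pos_set_def)

lemma ins_Zt_xn: "p \<in> Zt_xn (Suc n) \<Longrightarrow> s \<in> params \<Longrightarrow> ins (Suc n) s p \<in> Zt_xn n"
  using Zt_Zt_xn[OF params_Zt, of s n] unfolding Zt_xn_eq ins_def
  by (elim poly_ring_subst) auto

lemma ins_homog: "p \<in> homog d \<Longrightarrow> s \<in> params \<Longrightarrow> ins k s p \<in> homog d"
  unfolding ins_def by (erule homog_subst) (auto simp: params_homog split: var.splits)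

text \<open>This is the simplicial identity d_k d_l = d_{l-1} d_k for face maps; the inserted
  parameters do not interfere because insertions fix them.\<close>

lemma ins_ins:
  assumes "k < l" "s \<in> params" "u \<in> params"
  shows "ins k s (ins l u p) = ins (l - 1) u (ins k s p)"
proof -
  have *: "ins k s u = u" "ins (l - 1) u s = s" using assms by auto
  have "ins k s (ins l u p) = subst (\<lambda>v. ins k s (ins l u (Var v))) p"
    by (simp add: ins_def subst_subst)
  also have "\<dots> = subst (\<lambda>v. ins (l - 1) u (ins k s (Var v))) p"
  proof (rule subst_cong)
    fix v
    show "ins k s (ins l u (Var v)) = ins (l - 1) u (ins k s (Var v))"
    proof (cases v)
      case (X j)
      obtain l' where l: "l = Suc l'" using assms(1) by (cases l) auto
      consider "j < k" | "j = k" | j' where "j = Suc j'" "k \<le> j'" "j' < l'"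
        | "j = l" | j' where "j = Suc j'" "l' < j'"
        by (cases j; cases "j < k"; cases "j = k"; cases "j = l"; cases "j < l") (auto simp: l)
      then show ?thesis using assms(1) * by cases (simp_all add: X l)
    qed simp
  qed
  also have "\<dots> = ins (l - 1) u (ins k s p)"
    by (simp add: ins_def subst_subst)
  finally show ?thesis .
qed

text \<open>Induction on the degree, splitting off one variable. The clause for d = 0 compensates
  for the truncated d - 1: a quotient in degree 0 must vanish, or its product with a linear form
  would have the wrong degree.\<close>

lemma quotient_exists_monomial:
  assumes "s \<in> params" "i \<ge> 1" "single m c \<in> Pos" "mdeg m = d"
  shows "\<exists>g. (Var (X i) - s) * g = ins (Suc i) s (single m c) - ins i s (single m c)
           \<and> g \<in> Pos \<and> g \<in> homog (d - 1) \<and> (d = 0 \<longrightarrow> g = 0)"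
  using assms(3,4)
proof (induction d arbitrary: m)
  case 0
  then have "single m c = of_int c" by (simp add: mdeg_eq_0_iff single_0_int)
  then show ?case by (intro exI[of _ 0]) (simp add: ins_def)
next
  case (Suc d)
  then have "m \<noteq> 0" by (auto simp: mdeg_def)
  then obtain v where v: "v \<in> keys m" by (metis all_not_in_conv keys_eq_empty)
  define m' where "m' = m - single v 1"
  have m: "m = single v 1 + m'"
    using v by (intro poly_mapping_eqI)
      (auto simp: m'_def lookup_add lookup_minus lookup_single when_def in_keys_iff)
  have deg: "mdeg m' = d"
    using Suc.prems(2) by (simp add: m mdeg_add)
  have prod: "single m c = Var v * single m' c"
    by (simp add: m Var_def mult_single)
  have "keys m' \<subseteq> keys m"
    by (auto simp: m lookup_add in_keys_iff)
  then have "single m' c \<in> Pos"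
    using Suc.prems(1) by (auto simp: poly_ring_def vars_def split: if_splits)
  then obtain g where g: "(Var (X i) - s) * g = ins (Suc i) s (single m' c) - ins i s (single m' c)"
    "g \<in> Pos" "g \<in> homog (d - 1)" "d = 0 \<longrightarrow> g = 0"
    using Suc.IH deg by blast
  have vpos: "c \<noteq> 0 \<Longrightarrow> Var v \<in> Pos"
    unfolding poly_ring_Var using Suc.prems(1) v by (auto simp: poly_ring_def vars_def)
  \<comment> \<open>This is E_i of a single variable: 1 for x_i, -1 for x_{i+1}, and 0
    otherwise.\<close>
  define e :: mpoly where "e = (if v = X i then 1 else if v = X (Suc i) then -1 else 0)"
  have e: "(Var (X i) - s) * e = ins (Suc i) s (Var v) - ins i s (Var v)"
    using assms(2) by (cases v) (auto simp: e_def)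
  have e2: "e \<in> Pos" "e \<in> homog 0"
    by (auto simp: e_def homog_uminus)
  \<comment> \<open>The twisted Leibniz rule E(vq) = E(v) R^+(q) + R^-(v) E(q).\<close>
  let ?h = "e * ins (Suc i) s (single m' c) + ins i s (Var v) * g"
  have "(Var (X i) - s) * ?h = ((Var (X i) - s) * e) * ins (Suc i) s (single m' c)
      + ins i s (Var v) * ((Var (X i) - s) * g)"
    by (simp only: algebra_simps)
  also have "\<dots> = ins (Suc i) s (single m c) - ins i s (single m c)"
    unfolding e g(1) prod by (simp only: ins_mult) (simp only: algebra_simps)
  finally have 1: "(Var (X i) - s) * ?h = ins (Suc i) s (single m c) - ins i s (single m c)" .
  show ?case
  \<comment> \<open>For c = 0 the monomial does not occur in the polynomial, so nothing is known
    about the index of v.\<close>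
  proof (cases "c = 0")
    case True
    then show ?thesis by (intro exI[of _ 0]) simp
  next
    case False
    have "ins i s (Var v) * g \<in> homog d"
    proof (cases "d = 0")
      case False
      then show ?thesis
        using homog_mult[OF ins_homog[OF homog_Var[of v] assms(1), of i] g(3)] by simp
    qed (use g in simp)
    moreover have "e * ins (Suc i) s (single m' c) \<in> homog d"
      using homog_mult[OF e2(2) ins_homog[OF homog_single[of m' c] assms(1), of "Suc i"]] deg by simp
    ultimately have "?h \<in> homog d" by (rule homog_add[rotated])
    moreover have "?h \<in> Pos"
      using e2 g(2) \<open>single m' c \<in> Pos\<close> vpos[OF False] assms
      by (intro poly_ring_add poly_ring_mult ins_Pos) auto
    ultimately show ?thesis using 1 by (intro exI[of _ ?h]) simp
  qed
qed

lemma quotient_exists: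
  assumes "s \<in> params" "i \<ge> 1" "f \<in> Pos"
  obtains g where "(Var (X i) - s) * g = ins (Suc i) s f - ins i s f" "g \<in> Pos"
    "\<And>d. f \<in> homog (Suc d) \<Longrightarrow> g \<in> homog d"
proof -
  have "\<exists>g. (Var (X i) - s) * g
      = ins (Suc i) s (single m (lookup f m)) - ins i s (single m (lookup f m))
      \<and> g \<in> Pos \<and> g \<in> homog (mdeg m - 1)" if m: "m \<in> keys f" for m
  proof -
    have "single m (lookup f m) \<in> Pos"
      using assms(3) m by (auto simp: poly_ring_def vars_def)
    then show ?thesis
      using quotient_exists_monomial[OF assms(1,2) _ refl] by blast
  qed
  then obtain G where G: "\<And>m. m \<in> keys f \<Longrightarrow> (Var (X i) - s) * G m
      = ins (Suc i) s (single m (lookup f m)) - ins i s (single m (lookup f m))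
      \<and> G m \<in> Pos \<and> G m \<in> homog (mdeg m - 1)"
    by metis
  show ?thesis
  proof
    have "(Var (X i) - s) * (\<Sum>m\<in>keys f. G m)
        = ins (Suc i) s (\<Sum>m\<in>keys f. single m (lookup f m)) - ins i s (\<Sum>m\<in>keys f. single m (lookup f m))"
      using G by (simp add: sum_distrib_left sum_subtractf)
    then show "(Var (X i) - s) * (\<Sum>m\<in>keys f. G m) = ins (Suc i) s f - ins i s f"
      by (simp flip: poly_sum_single)
    show "(\<Sum>m\<in>keys f. G m) \<in> Pos" using G by blast
    show "(\<Sum>m\<in>keys f. G m) \<in> homog d" if "f \<in> homog (Suc d)" for d
    proof (rule homog_sum)
      fix m assume m: "m \<in> keys f"
      then have "mdeg m = Suc d" using that by (auto simp: homog_def)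
      then show "G m \<in> homog d" using G[OF m] by simp
    qed
  qed
qed

text \<open>Otherwise x_i would occur in an element of \<int>[t]. Cancelling this factor is what
  makes quotients unique.\<close>

lemma X_minus_param_nonzero: "s \<in> params \<Longrightarrow> Var (X i) - s \<noteq> 0"
  using vars_Var[of "X i"] by (auto simp: params_def Zt_def)

lemma E_eqI:
  assumes "s \<in> params" "(Var (X i) - s) * g = ins (Suc i) s f - ins i s f"
  shows "E i s f = g"
  unfolding E_def using assms(2)
proof (rule the_equality)
  fix h assume "(Var (X i) - s) * h = ins (Suc i) s f - ins i s f"
  then have "(Var (X i) - s) * h = (Var (X i) - s) * g" using assms(2) by simp
  then show "h = g" using X_minus_param_nonzero[OF assms(1)] by (simp add: mult_cancel_left)
qed

context
  fixes i :: nat and s :: mpoly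
  assumes si: "s \<in> params" "i \<ge> 1"
begin

lemma E_eq: "f \<in> Pos \<Longrightarrow> (Var (X i) - s) * E i s f = ins (Suc i) s f - ins i s f"
  by (metis quotient_exists E_eqI si)

lemma E_Pos: "f \<in> Pos \<Longrightarrow> E i s f \<in> Pos"
  by (metis quotient_exists E_eqI si)

lemma E_homog: "f \<in> Pos \<Longrightarrow> f \<in> homog (Suc d) \<Longrightarrow> E i s f \<in> homog d"
  by (metis quotient_exists E_eqI si)

lemma E_eq_0_iff: "f \<in> Pos \<Longrightarrow> E i s f = 0 \<longleftrightarrow> ins (Suc i) s f = ins i s f"
  by (metis E_eq E_eqI[OF si(1)] eq_iff_diff_eq_0 mult_zero_right)

lemma E_add: "f \<in> Pos \<Longrightarrow> g \<in> Pos \<Longrightarrow> E i s (f + g) = E i s f + E i s g"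
  by (rule E_eqI) (simp_all add: si E_eq distrib_left)

lemma E_diff: "f \<in> Pos \<Longrightarrow> g \<in> Pos \<Longrightarrow> E i s (f - g) = E i s f - E i s g"
  by (rule E_eqI) (simp_all add: si E_eq right_diff_distrib)

lemma E_scale: "a \<in> Zt \<Longrightarrow> f \<in> Pos \<Longrightarrow> E i s (a * f) = a * E i s f"
  using E_eq[of f] by (intro E_eqI) (simp_all add: si mult.left_commute right_diff_distrib)

lemma E_zero [simp]: "E i s 0 = 0"
  by (rule E_eqI) (simp_all add: si)

lemma E_sum: "(\<And>x. x \<in> A \<Longrightarrow> f x \<in> Pos) \<Longrightarrow> E i s (\<Sum>x\<in>A. f x) = (\<Sum>x\<in>A. E i s (f x))"
  by (induction A rule: infinite_finite_induct) (auto simp: E_add poly_ring_sum)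

lemma E_low: "f \<in> Zt_xn n \<Longrightarrow> n < i \<Longrightarrow> E i s f = 0"
  by (simp add: E_eq_0_iff Zt_xn_Pos ins_low)

lemma E_Zt: "f \<in> Zt \<Longrightarrow> E i s f = 0"
  by (simp add: E_eq_0_iff Zt_Pos)

end

text \<open>After multiplication by (x_j - s)(x_{i-1} - u), both sides become the same alternating
  sum of four double insertions, matched by \<open>ins_ins\<close>.\<close>

lemma E_commute:
  assumes "1 \<le> j" "Suc j < i" "s \<in> params" "u \<in> params" "f \<in> Pos"
  shows "E j s (E i u f) = E (i - 1) u (E j s f)"
proof -
  let ?a = "Var (X j) - s" and ?b = "Var (X (i - 1)) - u"
  \<comment> \<open>Insertion at j or j + 1, both below i, shifts x_i to x_{i-1}; this is the source
    of the index i - 1 and of the condition i > j + 1.\<close>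
  have fix1: "ins k s (Var (X i) - u) = ?b" if "k = j \<or> k = Suc j" for k
    using assms that by auto
  have fix2: "ins k u ?a = ?a" if "k = i \<or> k = i - 1" for k
    using assms that by auto
  have Pos: "E i u f \<in> Pos" "E j s f \<in> Pos"
    using assms by (auto intro: E_Pos)
  have "?b * (?a * E j s (E i u f)) = ?b * ins (Suc j) s (E i u f) - ?b * ins j s (E i u f)"
    using Pos assms by (simp add: E_eq right_diff_distrib)
  also have "\<dots> = ins (Suc j) s ((Var (X i) - u) * E i u f) - ins j s ((Var (X i) - u) * E i u f)"
    unfolding ins_mult using fix1 by simp
  also have "\<dots> = (ins (Suc j) s (ins (Suc i) u f) - ins (Suc j) s (ins i u f))
       - (ins j s (ins (Suc i) u f) - ins j s (ins i u f))"
    using assms by (simp add: E_eq)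
  also have "\<dots> = (ins i u (ins (Suc j) s f) - ins (i - 1) u (ins (Suc j) s f))
       - (ins i u (ins j s f) - ins (i - 1) u (ins j s f))"
    using assms by (simp add: ins_ins[of _ _ s u])
  also have "\<dots> = ins i u (?a * E j s f) - ins (i - 1) u (?a * E j s f)"
    using assms by (simp add: E_eq)
  also have "\<dots> = ?a * (ins (Suc (i - 1)) u (E j s f) - ins (i - 1) u (E j s f))"
    unfolding ins_mult using fix2 assms by (simp add: right_diff_distrib)
  also have "\<dots> = ?a * (?b * E (i - 1) u (E j s f))"
    using Pos assms by (subst E_eq) auto
  finally have "?b * ?a * E j s (E i u f) = ?b * ?a * E (i - 1) u (E j s f)"
    by (simp add: algebra_simps)
  then show ?thesis
    using X_minus_param_nonzero assms by simp
qed

text \<open>If p involves only x_1, ..., x_m with m > n, insertion at m + 1 does nothing while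
  insertion at m replaces x_m by a parameter. Their equality eliminates x_m, and this descends to
  n.\<close>

lemma E_zero_imp_Zt_xn:
  assumes "p \<in> Pos" "\<And>i. i > n \<Longrightarrow> u i \<in> params" "\<And>i. i > n \<Longrightarrow> E i (u i) p = 0"
  shows "p \<in> Zt_xn n"
proof -
  have "p \<in> Zt_xn m \<Longrightarrow> p \<in> Zt_xn n" for m
  proof (induction m)
    case 0
    then show ?case by (rule Zt_xn_mono) simp
  next
    case (Suc m)
    show ?case
    proof (cases "Suc m \<le> n")
      case False
      then have "ins (Suc (Suc m)) (u (Suc m)) p = ins (Suc m) (u (Suc m)) p"
        using assms by (subst E_eq_0_iff[symmetric]) auto
      then have "p = ins (Suc m) (u (Suc m)) p"
        using Suc.prems by (simp add: ins_low)
      also have "\<dots> \<in> Zt_xn m"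
        using Suc.prems assms False by (intro ins_Zt_xn) auto
      finally show ?thesis by (rule Suc.IH)
    qed (use Suc.prems Zt_xn_mono in blast)
  qed
  then show ?thesis using Pos_Zt_xn[OF assms(1)] by blast
qed

lemma E_zero_imp_Zt:
  assumes "p \<in> Pos" "\<And>i. i \<ge> 1 \<Longrightarrow> u i \<in> params" "\<And>i. i \<ge> 1 \<Longrightarrow> E i (u i) p = 0"
  shows "p \<in> Zt"
  using E_zero_imp_Zt_xn[of p 0 u] assms by (simp add: Zt_xn_0)

subsection \<open>Indexed forests and their codes\<close>

text \<open>Inverse construction to \<open>tdel\<close>: the leaf labelled i sprouts two leaves.
  Unlike deletion it works at every leaf, which makes its effect on codes easy to compute.\<close>

fun tins :: "tree \<Rightarrow> nat \<Rightarrow> nat \<Rightarrow> tree" where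
  "tins Leaf a i = (if a = i then Node Leaf Leaf else Leaf)"
| "tins (Node l r) a i = Node (tins l a i) (tins r (a + leaves l) i)"

definition fins :: "forest \<Rightarrow> nat \<Rightarrow> forest" where
  "fins F i = (\<lambda>k. tins (F k) (base F k) i)"

lemma leaves_pos: "leaves t \<ge> 1"
  by (induction t) auto

lemma leaves_tins: "leaves (tins t a i) = leaves t + (if a \<le> i \<and> i < a + leaves t then 1 else 0)"
  by (induction t arbitrary: a) (auto simp: add.assoc)

lemma tins_outside: "\<not> (a \<le> i \<and> i < a + leaves t) \<Longrightarrow> tins t a i = t"
  by (induction t arbitrary: a) auto

lemma tcode_outside: "\<not> (a \<le> i \<and> i < a + leaves t) \<Longrightarrow> tcode t a i = 0"
proof (induction t arbitrary: a)
  case (Node l r)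
  then show ?case using leaves_pos[of l] by auto
qed auto

text \<open>The new node v has rho(v) = i, and the new leaf i + 1 is a right child, hence never a
  value of rho: c_i grows by one and a 0 enters at i + 1. The shifted start accounts for trees lying
  to the right of leaf i.\<close>

lemma tcode_tins:
  "tcode (tins t a i) (a + (if i < a then 1 else 0)) j =
     (if j < i then tcode t a j
      else if j = i then tcode t a i + (if a \<le> i \<and> i < a + leaves t then 1 else 0)
      else if j = Suc i then 0
      else tcode t a (j - 1))"
proof (induction t arbitrary: a)
  case (Node l r)
  have base: "(a + (if i < a then 1 else 0)) + leaves (tins l a i)
      = (a + leaves l) + (if i < a + leaves l then 1 else 0)"
    by (auto simp: leaves_tins)
  show ?case
    unfolding tins.simps tcode.simps base Node.IH by auto
qed auto

text \<open>One conditional equation instead of defining equations that apply only after both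
  children are split into cases.\<close>

lemma tdel_Node: "tdel (Node l r) a i =
    (if l = Leaf \<and> r = Leaf then (if a = i then Leaf else Node Leaf Leaf)
     else Node (tdel l a i) (tdel r (a + leaves l) i))"
  by (cases l; cases r) auto

lemma tqdes_Node: "tqdes (Node l r) a =
    (if l = Leaf \<and> r = Leaf then {a} else tqdes l a \<union> tqdes r (a + leaves l))"
  by (cases l; cases r) auto

text \<open>A terminal node owns both leaves i and i + 1, hence the stronger upper bound.\<close>

lemma tqdes_range: "i \<in> tqdes t a \<Longrightarrow> a \<le> i \<and> Suc i < a + leaves t"
proof (induction t arbitrary: a)
  case (Node l r)
  show ?case
  proof (cases "l = Leaf \<and> r = Leaf")
    case False
    then consider "i \<in> tqdes l a" | "i \<in> tqdes r (a + leaves l)"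
      using Node.prems by (auto simp: tqdes_Node)
    then show ?thesis
    proof cases
      case 1
      then show ?thesis using Node.IH(1)[OF 1] leaves_pos[of r] by auto
    next
      case 2
      then show ?thesis using Node.IH(2)[OF 2] by auto
    qed
  qed (use Node.prems in auto)
qed auto

lemma tqdes_Node_cases:
  assumes "i \<in> tqdes (Node l r) a" "\<not> (l = Leaf \<and> r = Leaf)"
  shows "i \<in> tqdes l a \<longleftrightarrow> i \<notin> tqdes r (a + leaves l)"
proof -
  have "i \<in> tqdes l a \<or> i \<in> tqdes r (a + leaves l)"
    using assms by (auto simp: tqdes_Node)
  moreover have "\<not> (i \<in> tqdes l a \<and> i \<in> tqdes r (a + leaves l))"
    using tqdes_range[of i l a] tqdes_range[of i r "a + leaves l"] by auto
  ultimately show ?thesis by blast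
qed

lemma tqdes_nonempty: "t \<noteq> Leaf \<Longrightarrow> tqdes t a \<noteq> {}"
  by (induction t arbitrary: a) (auto simp: tqdes_Node)

lemma tdel_outside: "i \<notin> tqdes t a \<Longrightarrow> tdel t a i = t"
  by (induction t arbitrary: a) (auto simp: tdel_Node tqdes_Node split: if_splits)

lemma leaves_tdel: "i \<in> tqdes t a \<Longrightarrow> Suc (leaves (tdel t a i)) = leaves t"
proof (induction t arbitrary: a)
  case (Node l r)
  show ?case
  proof (cases "l = Leaf \<and> r = Leaf")
    case False
    consider "i \<in> tqdes l a" "i \<notin> tqdes r (a + leaves l)"
      | "i \<notin> tqdes l a" "i \<in> tqdes r (a + leaves l)"
      using tqdes_Node_cases[OF Node.prems False] by blast
    then show ?thesis
    proof cases
      case 1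
      then show ?thesis using Node.IH(1)[OF 1(1)] False by (auto simp: tdel_Node tdel_outside)
    next
      case 2
      then show ?thesis using Node.IH(2)[OF 2(2)] False by (auto simp: tdel_Node tdel_outside)
    qed
  qed (use Node.prems in auto)
qed auto

lemma tins_tdel: "i \<in> tqdes t a \<Longrightarrow> tins (tdel t a i) a i = t"
proof (induction t arbitrary: a)
  case (Node l r)
  show ?case
  proof (cases "l = Leaf \<and> r = Leaf")
    case False
    consider (l) "i \<in> tqdes l a" "i \<notin> tqdes r (a + leaves l)"
      | (r) "i \<notin> tqdes l a" "i \<in> tqdes r (a + leaves l)"
      using tqdes_Node_cases[OF Node.prems False] by blast
    then show ?thesis
    proof cases
      \<comment> \<open>After the deletion the right subtree starts one label earlier. It still
        starts above i because leaf i + 1 belonged to l, so insertion leaves it alone.\<close>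
      case l
      then show ?thesis
        using Node.IH(1)[OF l(1)] leaves_tdel[OF l(1)] tqdes_range[OF l(1)] False
        by (auto simp: tdel_Node tdel_outside intro!: tins_outside)
    next
      case r
      then show ?thesis
        using Node.IH(2)[OF r(2)] tqdes_range[OF r(2)] False
        by (auto simp: tdel_Node tdel_outside intro!: tins_outside)
    qed
  qed (use Node.prems in auto)
qed auto

text \<open>The lowest node v with rho(v) = i has leaf i as left child. Its right subtree starts at
  i + 1, and a non-leaf root there would contribute to the code at i + 1.\<close>

lemma tcode_imp_tqdes: "0 < tcode t a i \<Longrightarrow> tcode t a (Suc i) = 0 \<Longrightarrow> i \<in> tqdes t a"
proof (induction t arbitrary: a)
  case (Node l r)
  have root: "tcode t b b = 0 \<Longrightarrow> t = Leaf" for t b by (cases t) auto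
  show ?case
  proof (cases "0 < tcode l a i \<or> 0 < tcode r (a + leaves l) i")
    case True
    then have "i \<in> tqdes l a \<union> tqdes r (a + leaves l)"
      using Node.IH Node.prems(2) by auto
    then show ?thesis by (auto simp: tqdes_Node)
  next
    case False
    then have "i = a" using Node.prems(1) by (auto split: if_splits)
    then have "l = Leaf" using False root by auto
    then have "r = Leaf" using Node.prems(2) root \<open>i = a\<close> by auto
    then show ?thesis using \<open>l = Leaf\<close> \<open>i = a\<close> by simp
  qed
qed auto

section \<open>Leaf labels and codes of whole forests\<close>

lemma base_0 [simp]: "base F 0 = 1"
  and base_Suc: "base F (Suc k) = base F k + leaves (F k)"
  by (simp_all add: base_def)

lemma base_mono: "k \<le> l \<Longrightarrow> base F k \<le> base F l"
  by (rule lift_Suc_mono_le[of "base F"]) (auto simp: base_Suc)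

lemma base_ge: "Suc k \<le> base F k"
proof (induction k)
  case (Suc k)
  then show ?case using leaves_pos[of "F k"] by (simp add: base_Suc)
qed simp

lemma base_interval_unique:
  assumes "base F k \<le> i" "i < base F (Suc k)" "base F l \<le> i" "i < base F (Suc l)"
  shows "k = l"
proof (rule ccontr)
  assume "k \<noteq> l"
  then consider "Suc k \<le> l" | "Suc l \<le> k" by linarith
  then show False
    using assms base_mono[of "Suc k" l F] base_mono[of "Suc l" k F] by cases auto
qed

lemma code_extend:
  assumes "i \<le> K"
  shows "code F i = (\<Sum>k<K. tcode (F k) (base F k) i)"
  unfolding code_def
proof (rule sum.mono_neutral_left)
  show "\<forall>k\<in>{..<K} - {..<i}. tcode (F k) (base F k) i = 0"
  proof
    fix k assume "k \<in> {..<K} - {..<i}"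
    then show "tcode (F k) (base F k) i = 0"
      using base_ge[of k F] by (intro tcode_outside) auto
  qed
qed (use assms in auto)

lemma base_fins: "i \<ge> 1 \<Longrightarrow> base (fins F i) k = base F k + (if i < base F k then 1 else 0)"
  by (induction k) (auto simp: base_Suc fins_def leaves_tins)

text \<open>\<open>tcode_tins\<close> is summed over the trees. Exactly one of them contains leaf i,
  so the indicators add up to one.\<close>

lemma code_fins:
  assumes "i \<ge> 1"
  shows "code (fins F i) j = (if j < i then code F j else if j = i then Suc (code F i)
           else if j = Suc i then 0 else code F (j - 1))"
proof -
  define K where "K = Suc (i + j)"
  \<comment> \<open>The label intervals of the trees are consecutive and disjoint, so among the
    first M trees leaf i is found once or not at all.\<close>
  have ind: "(\<Sum>k<M. if base F k \<le> i \<and> i < base F k + leaves (F k) then 1 else 0 :: nat)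
      = (if i < base F M then 1 else 0)" for M
    using assms by (induction M) (auto simp: base_Suc)
  have "i < base F K" using base_ge[of K F] by (simp add: K_def)
  note ind = ind[of K, unfolded if_P[OF this]]
  have "code (fins F i) j = (\<Sum>k<K. tcode (fins F i k) (base (fins F i) k) j)"
    by (rule code_extend) (simp add: K_def)
  also have "\<dots> = (\<Sum>k<K. if j < i then tcode (F k) (base F k) j
      else if j = i then tcode (F k) (base F k) i
         + (if base F k \<le> i \<and> i < base F k + leaves (F k) then 1 else 0)
      else if j = Suc i then 0
      else tcode (F k) (base F k) (j - 1))"
    unfolding base_fins[OF assms] unfolding fins_def tcode_tins ..
  also have "\<dots> = (if j < i then code F j else if j = i then Suc (code F i)
           else if j = Suc i then 0 else code F (j - 1))"
  proof -
    have K: "i \<le> K" "j \<le> K" "j - 1 \<le> K" by (auto simp: K_def)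
    show ?thesis using ind by (simp add: code_extend[OF K(1)] code_extend[OF K(2)]
      code_extend[OF K(3)] sum.distrib del: One_nat_def)
  qed
  finally show ?thesis .
qed

text \<open>Only the tree containing the terminal node changes, and the trees to its right move by
  one label. The effect of deletion on codes is then read off from that of insertion.\<close>

lemma fins_fdel:
  assumes "i \<in> Qdes F"
  shows "fins (fdel F i) i = F"
proof -
  obtain k0 where k0: "i \<in> tqdes (F k0) (base F k0)"
    using assms by (auto simp: Qdes_def)
  have range0: "base F k0 \<le> i" "Suc i < base F (Suc k0)"
    using tqdes_range[OF k0] by (auto simp: base_Suc)
  have notin: "i \<notin> tqdes (F k) (base F k)" if "k \<noteq> k0" for k
    using tqdes_range[of i "F k" "base F k"] range0 base_interval_unique[of F k i k0] that
    by (auto simp: base_Suc)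
  have base: "base F k = base (fdel F i) k + (if k0 < k then 1 else 0)" for k
  proof (induction k)
    case (Suc k)
    consider "k < k0" | "k = k0" | "k > k0" by linarith
    then show ?case
      using Suc leaves_tdel[OF k0] tdel_outside[OF notin, of k]
      by cases (auto simp: base_Suc fdel_def)
  qed simp
  show ?thesis
  proof
    fix k
    consider (lt) "k < k0" | (eq) "k = k0" | (gt) "k > k0" by linarith
    then show "fins (fdel F i) i k = F k"
    proof cases
      case lt
      then have "base F (Suc k) \<le> i" using range0 base_mono[of "Suc k" k0 F] by auto
      then show ?thesis
        using lt base[of k] tdel_outside[OF notin, of k]
        by (auto simp: fins_def fdel_def base_Suc intro!: tins_outside)
    next
      case eq
      then show ?thesis
        using base[of k] tins_tdel[OF k0] by (simp add: fins_def fdel_def)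
    next
      case gt
      then have "Suc i < base F k" using range0 base_mono[of "Suc k0" k F] by auto
      then show ?thesis
        using gt base[of k] tdel_outside[OF notin, of k]
        by (auto simp: fins_def fdel_def intro!: tins_outside)
    qed
  qed
qed

lemma is_forest_fins:
  assumes "is_forest F"
  shows "is_forest (fins F i)"
proof -
  \<comment> \<open>A trivial tree becomes nontrivial only if its single leaf is i, and
    \<open>base_ge\<close> bounds its index.\<close>
  have "{k. fins F i k \<noteq> Leaf} \<subseteq> {k. F k \<noteq> Leaf} \<union> {..i}"
  proof
    fix k assume k: "k \<in> {k. fins F i k \<noteq> Leaf}"
    show "k \<in> {k. F k \<noteq> Leaf} \<union> {..i}"
    proof (cases "F k = Leaf")
      case True
      then have "base F k = i" using k by (auto simp: fins_def split: if_splits)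
      then show ?thesis using base_ge[of k F] by auto
    qed auto
  qed
  then show ?thesis
    using assms by (auto simp: is_forest_def intro: finite_subset)
qed

lemma is_forest_fdel:
  assumes "is_forest F"
  shows "is_forest (fdel F i)"
proof -
  have "{k. fdel F i k \<noteq> Leaf} \<subseteq> {k. F k \<noteq> Leaf}"
    by (auto simp: fdel_def)
  then show ?thesis
    using assms by (auto simp: is_forest_def intro: finite_subset)
qed

lemma is_forest_empty [simp]: "is_forest empty_forest"
  by (simp add: is_forest_def empty_forest_def)

lemma Qdes_empty [simp]: "Qdes empty_forest = {}"
  by (simp add: Qdes_def empty_forest_def)

lemma code_empty [simp]: "code empty_forest i = 0"
  by (simp add: code_def empty_forest_def)

lemma code_finite_support:
  assumes "is_forest F"
  obtains N where "\<And>i. i > N \<Longrightarrow> code F i = 0"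
proof -
  obtain M where M: "\<And>k. F k \<noteq> Leaf \<Longrightarrow> k < M"
    using assms finite_nat_set_iff_bounded by (auto simp: is_forest_def)
  have "code F i = 0" if i: "i > base F M" for i
    unfolding code_def
  proof (rule sum.neutral, rule ballI)
    fix k
    show "tcode (F k) (base F k) i = 0"
    proof (cases "F k = Leaf")
      case False
      then have "base F (Suc k) \<le> base F M" using M by (intro base_mono) (simp add: Suc_leI)
      then show ?thesis using i by (intro tcode_outside) (auto simp: base_Suc)
    qed simp
  qed
  then show ?thesis by (rule that)
qed

lemma Qdes_pos: "i \<in> Qdes F \<Longrightarrow> i \<ge> 1"
proof -
  assume "i \<in> Qdes F"
  then obtain k where "i \<in> tqdes (F k) (base F k)" by (auto simp: Qdes_def)
  then show ?thesis using tqdes_range[of i "F k" "base F k"] base_ge[of k F] by auto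
qed

text \<open>With this criterion, combinatorial questions about deletions become arithmetic on
  codes.\<close>

lemma Qdes_iff_code: "i \<in> Qdes F \<longleftrightarrow> i \<ge> 1 \<and> 0 < code F i \<and> code F (Suc i) = 0"
proof
  assume i: "i \<in> Qdes F"
  then show "i \<ge> 1 \<and> 0 < code F i \<and> code F (Suc i) = 0"
    using code_fins[OF Qdes_pos[OF i], of "fdel F i"] Qdes_pos[OF i] by (auto simp: fins_fdel)
next
  assume i: "i \<ge> 1 \<and> 0 < code F i \<and> code F (Suc i) = 0"
  then have "code F i \<noteq> 0" by simp
  then have "\<exists>k\<in>{..<i}. tcode (F k) (base F k) i \<noteq> 0"
    unfolding code_def by (rule contrapos_np) simp
  then obtain k where k: "k < i" "0 < tcode (F k) (base F k) i" by auto
  have "code F (Suc i) = 0" using i by blast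
  then have "\<forall>k\<in>{..<Suc i}. tcode (F k) (base F k) (Suc i) = 0"
    unfolding code_def sum_eq_0_iff[OF finite_lessThan] .
  then show "i \<in> Qdes F"
    using tcode_imp_tqdes[OF k(2)] k(1) by (auto simp: Qdes_def)
qed

lemma code_fdel:
  assumes "i \<in> Qdes F"
  shows "code (fdel F i) j = (if j < i then code F j else if j = i then code F i - 1 else code F (Suc j))"
  using code_fins[OF Qdes_pos[OF assms], of "fdel F i"] by (auto simp: fins_fdel[OF assms])

section \<open>Induction on the number of internal nodes; codes as a bijection\<close>

lemma Qdes_nonempty:
  assumes "F \<noteq> empty_forest"
  obtains i where "i \<in> Qdes F"
proof -
  obtain k where "F k \<noteq> Leaf" using assms by (auto simp: empty_forest_def)
  then show ?thesis using tqdes_nonempty[of "F k" "base F k"] that by (auto simp: Qdes_def)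
qed

text \<open>A binary tree has one internal node fewer than leaves, so this counts internal nodes; it
  will be the degree of the double forest polynomial.\<close>

definition fsize :: "forest \<Rightarrow> nat" where
  "fsize F = (\<Sum>k | F k \<noteq> Leaf. leaves (F k) - 1)"

lemma fsize_fdel:
  assumes "is_forest F" "i \<in> Qdes F"
  shows "fsize F = Suc (fsize (fdel F i))"
proof -
  obtain k0 where k0: "i \<in> tqdes (F k0) (base F k0)"
    using assms by (auto simp: Qdes_def)
  let ?A = "{k. F k \<noteq> Leaf}"
  have fin: "finite ?A" using assms by (simp add: is_forest_def)
  have "F k0 \<noteq> Leaf" using k0 by auto
  then have k0A: "k0 \<in> ?A" by simp
  have same: "fdel F i k = F k" if "k \<noteq> k0" for k
  proof -
    have "i \<notin> tqdes (F k) (base F k)"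
      using tqdes_range[of i "F k" "base F k"] tqdes_range[OF k0]
        base_interval_unique[of F k i k0] that by (auto simp: base_Suc)
    then show ?thesis by (simp add: fdel_def tdel_outside)
  qed
  have del: "Suc (leaves (fdel F i k0)) = leaves (F k0)"
    using leaves_tdel[OF k0] by (simp add: fdel_def)
  have "fsize (fdel F i) = (\<Sum>k\<in>?A. leaves (fdel F i k) - 1)"
    unfolding fsize_def
    by (rule sum.mono_neutral_left) (use fin in \<open>auto simp: fdel_def\<close>)
  also have "\<dots> = (leaves (fdel F i k0) - 1) + (\<Sum>k\<in>?A - {k0}. leaves (F k) - 1)"
    using fin k0A same by (simp add: sum.remove)
  also have "Suc \<dots> = (leaves (F k0) - 1) + (\<Sum>k\<in>?A - {k0}. leaves (F k) - 1)"
    using del leaves_pos[of "fdel F i k0"] by linarith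
  also have "\<dots> = fsize F"
    unfolding fsize_def using fin k0A by (simp add: sum.remove)
  finally show ?thesis by simp
qed

text \<open>Equal codes give equal Qdes; deleting at a common element keeps the codes equal, and
  reinsertion recovers both forests.\<close>

lemma code_inject:
  assumes "is_forest F" "is_forest G" "\<And>i. i \<ge> 1 \<Longrightarrow> code F i = code G i"
  shows "F = G"
  using assms
proof (induction "fsize F" arbitrary: F G rule: less_induct)
  case less
  have eq: "code F i = code G i" for i
    using less.prems(3)[of i] by (cases i) (auto simp: code_def)
  then have Q: "Qdes F = Qdes G"
    by (auto simp: Qdes_iff_code)
  show ?case
  proof (cases "F = empty_forest")
    case True
    then show ?thesis using Q Qdes_nonempty[of G] by auto
  next
    case False
    then obtain i where i: "i \<in> Qdes F" by (rule Qdes_nonempty)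
    have "fdel F i = fdel G i"
    proof (rule less.hyps)
      show "fsize (fdel F i) < fsize F" using fsize_fdel less.prems i by simp
      show "code (fdel F i) j = code (fdel G i) j" for j
        using i Q eq by (simp add: code_fdel)
    qed (use less.prems is_forest_fdel in auto)
    then show ?thesis using fins_fdel[OF i] fins_fdel[of i G] i Q by simp
  qed
qed

lemma code_surject:
  assumes "\<And>i. i > N \<Longrightarrow> c i = 0"
  obtains F where "is_forest F" "\<And>i. i \<ge> 1 \<Longrightarrow> code F i = c i"
proof -
  have "\<exists>F. is_forest F \<and> (\<forall>i\<ge>1. code F i = c i)"
    using assms
  proof (induction "\<Sum>i=1..N. c i" arbitrary: c)
    case 0
    then have "c i = 0" if "i \<ge> 1" for i
      using that by (cases "i > N") auto
    then show ?case by (intro exI[of _ empty_forest]) simp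
  next
    case (Suc m)
    let ?I = "{i\<in>{1..N}. c i \<noteq> 0}"
    have "?I \<noteq> {}"
    proof
      assume "?I = {}"
      then have "(\<Sum>i=1..N. c i) = 0" by auto
      then show False using Suc.hyps(2) by simp
    qed
    \<comment> \<open>At the rightmost nonzero entry, the 0 inserted at i + 1 and the resulting
      shift only move zeros.\<close>
    define i where "i = Max ?I"
    have "i \<in> ?I" using \<open>?I \<noteq> {}\<close> unfolding i_def by (intro Max_in) auto
    then have i: "1 \<le> i" "i \<le> N" "c i \<noteq> 0" by auto
    have above: "c j = 0" if "j > i" for j
    proof (rule ccontr)
      assume "c j \<noteq> 0"
      moreover from this have "j \<le> N" using Suc.prems by (meson not_le)
      ultimately have "j \<in> ?I" using that i by auto
      then have "j \<le> i" unfolding i_def by (intro Max_ge) auto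
      then show False using that by simp
    qed
    define c' where "c' = c(i := c i - 1)"
    have "(\<Sum>i=1..N. c i) = c i + (\<Sum>j\<in>{1..N} - {i}. c j)"
      "(\<Sum>i=1..N. c' i) = c' i + (\<Sum>j\<in>{1..N} - {i}. c j)"
      using i by (simp_all add: sum.remove c'_def)
    then have "m = (\<Sum>i=1..N. c' i)" using Suc.hyps(2) i by (simp add: c'_def)
    moreover have "c' j = 0" if "j > N" for j using that i Suc.prems by (auto simp: c'_def)
    ultimately obtain F where F: "is_forest F" "\<And>j. j \<ge> 1 \<Longrightarrow> code F j = c' j"
      using Suc.hyps(1) by blast
    have "code (fins F i) j = c j" if "j \<ge> 1" for j
      using that i above F(2) by (auto simp: code_fins c'_def)
    then show ?case using is_forest_fins[OF F(1)] by blast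
  qed
  then show ?thesis using that by blast
qed

lemma Qdes_fins: "i \<ge> 1 \<Longrightarrow> i \<in> Qdes (fins F i)"
  by (simp add: Qdes_iff_code code_fins)

lemma fdel_fins:
  assumes "is_forest F" "i \<ge> 1"
  shows "fdel (fins F i) i = F"
  by (rule code_inject)
     (use assms in \<open>auto simp: is_forest_fins is_forest_fdel code_fdel Qdes_fins code_fins\<close>)

lemma fdel_inject: "i \<in> Qdes F \<Longrightarrow> i \<in> Qdes G \<Longrightarrow> fdel F i = fdel G i \<Longrightarrow> F = G"
  by (metis fins_fdel)

text \<open>Both sides amount to i and j lying in Qdes F: deletion at i leaves entries j and j + 1
  alone, and deletion at j moves entries i and i + 1 down by one.\<close>

lemma Qdes_fdel_swap:
  assumes "1 \<le> j" "Suc j < i"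
  shows "i \<in> Qdes F \<and> j \<in> Qdes (fdel F i) \<longleftrightarrow> j \<in> Qdes F \<and> i - 1 \<in> Qdes (fdel F j)"
proof -
  have "i \<in> Qdes F \<and> j \<in> Qdes (fdel F i) \<longleftrightarrow> i \<in> Qdes F \<and> j \<in> Qdes F"
    using assms by (auto simp: Qdes_iff_code[of j] code_fdel)
  moreover obtain i' where i': "i = Suc i'" using assms(2) by (cases i) auto
  have "j \<in> Qdes F \<and> i - 1 \<in> Qdes (fdel F j) \<longleftrightarrow> j \<in> Qdes F \<and> i \<in> Qdes F"
    using assms by (auto simp: i' Qdes_iff_code[of i'] Qdes_iff_code[of "Suc i'"] code_fdel)
  ultimately show ?thesis by blast
qed

lemma fdel_swap:
  assumes "1 \<le> j" "Suc j < i" "is_forest F" "i \<in> Qdes F" "j \<in> Qdes (fdel F i)"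
  shows "fdel (fdel F i) j = fdel (fdel F j) (i - 1)"
proof (rule code_inject)
  have j: "j \<in> Qdes F" "i - 1 \<in> Qdes (fdel F j)"
    using Qdes_fdel_swap assms by blast+
  obtain i' where i': "i = Suc i'" using assms(2) by (cases i) auto
  fix k
  have "code (fdel (fdel F i) j) k = (if k < j then code F k else if k = j then code F j - 1
      else if Suc k < i then code F (Suc k) else if Suc k = i then code F i - 1
      else code F (Suc (Suc k)))"
    using assms by (simp add: code_fdel[of j "fdel F i"] code_fdel[of i F])
  also have "\<dots> = code (fdel (fdel F j) (i - 1)) k"
    using assms j by (simp add: i' code_fdel[of i' "fdel F j"] code_fdel[of j F])
  finally show "code (fdel (fdel F i) j) k = code (fdel (fdel F j) (i - 1)) k" .
qed (use assms in \<open>auto intro: is_forest_fdel\<close>)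

text \<open>The case i = j + 1 is excluded by the 0 that insertion places there. The strict bound on
  i - 1 makes \<open>E_commute\<close> applicable in the elimination of x_M.\<close>

lemma Qdes_fins_above:
  assumes "is_forest F" "j \<ge> 1" "i \<in> Qdes (fins F j)" "i > j"
  shows "i - 1 \<in> Qdes F \<and> i - 1 > j"
proof -
  have "i \<noteq> Suc j"
    using assms by (auto simp: Qdes_iff_code code_fins)
  then show ?thesis
    using assms by (auto simp: Qdes_iff_code code_fins)
qed

lemma Qdes_bounded:
  assumes "is_forest F"
  obtains N where "\<And>i. i \<in> Qdes F \<Longrightarrow> i \<le> N"
  using code_finite_support[OF assms] by (metis Qdes_iff_code less_irrefl not_le)

subsection \<open>Zigzag forests and padded compositions\<close>

lemma forest_of_comp:
  shows is_forest_of_comp: "is_forest (forest_of_comp c)"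
    and code_forest_of_comp: "i \<ge> 1 \<Longrightarrow>
      code (forest_of_comp c) i = (if i \<le> length c then c ! (i - 1) else 0)"
proof -
  let ?c = "\<lambda>i. if i \<le> length c then c ! (i - 1) else 0"
  obtain F where F: "is_forest F" "\<And>i. i \<ge> 1 \<Longrightarrow> code F i = ?c i"
    by (rule code_surject[of "length c" ?c]) auto
  have "\<exists>!F. is_forest F \<and> (\<forall>i\<ge>1. code F i = ?c i)"
    using F by (intro ex1I[of _ F]) (auto intro!: code_inject)
  from theI'[OF this] show "is_forest (forest_of_comp c)"
    "i \<ge> 1 \<Longrightarrow> code (forest_of_comp c) i = ?c i"
    unfolding forest_of_comp_def by blast+
qed

lemma forest_of_comp_eqI:
  assumes "is_forest F" "\<And>i. i \<ge> 1 \<Longrightarrow> code F i = (if i \<le> length c then c ! (i - 1) else 0)"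
  shows "forest_of_comp c = F"
  by (rule code_inject) (use assms in \<open>auto simp: is_forest_of_comp code_forest_of_comp\<close>)

lemma Qdes_forest_of_comp:
  assumes "padded_comp n c"
  shows "i \<in> Qdes (forest_of_comp c) \<longleftrightarrow> i = n \<and> n \<ge> 1 \<and> c ! (n - 1) > 0"
proof
  have len: "length c = n" using assms by (simp add: padded_comp_def)
  assume "i \<in> Qdes (forest_of_comp c)"
  \<comment> \<open>Lists count from 0, so \<open>c ! i\<close> is the code entry at i + 1.\<close>
  then have i: "i \<ge> 1" "i \<le> n" "c ! (i - 1) > 0" "i < n \<Longrightarrow> c ! i = 0"
    using len by (auto simp: Qdes_iff_code code_forest_of_comp split: if_splits)
  have "\<not> i < n"
  proof
    assume "i < n"
    moreover from this have "c ! i > 0"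
      using assms i unfolding padded_comp_def by (metis diff_less less_one less_le_trans)
    ultimately show False using i by simp
  qed
  then show "i = n \<and> n \<ge> 1 \<and> c ! (n - 1) > 0" using i by auto
next
  assume "i = n \<and> n \<ge> 1 \<and> c ! (n - 1) > 0"
  then show "i \<in> Qdes (forest_of_comp c)"
    using assms by (auto simp: Qdes_iff_code code_forest_of_comp padded_comp_def)
qed

lemma Zigzag_eq:
  "Zigzag n = forest_of_comp ` {c. padded_comp n c}"
proof (intro equalityI subsetI)
  fix F assume "F \<in> Zigzag n"
  then have F: "is_forest F" "\<And>i. i \<ge> 1 \<Longrightarrow> 0 < code F i \<Longrightarrow> code F (Suc i) = 0 \<Longrightarrow> i = n"
    by (auto simp: Zigzag_def Qdes_iff_code subset_iff)
  obtain N where N: "\<And>i. i > N \<Longrightarrow> code F i = 0"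
    using code_finite_support[OF F(1)] by blast
  \<comment> \<open>Positivity spreads to the right and can stop only at n: from i <= n it reaches
    n, and from i > n it would never stop, against finite support.\<close>
  have climb: "code F j > 0" if "i \<ge> 1" "0 < code F i" "i \<le> j" "j \<le> n \<or> n < i" for i j
    using that(3,4)
  proof (induction j rule: dec_induct)
    case base
    then show ?case using that by simp
  next
    case (step j)
    then have "0 < code F j" "j \<noteq> n" by auto
    then show ?case using F(2)[of j] step(1) that(1) by (meson gr0I order_trans)
  qed
  have zero: "code F i = 0" if "i > n" for i
  proof (rule ccontr)
    assume "code F i \<noteq> 0"
    then have "code F (max i (Suc N)) > 0" by (intro climb[OF _ _ max.cobounded1]) (use that in linarith)+
    moreover have "code F (max i (Suc N)) = 0" by (rule N) simp
    ultimately show False by simp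
  qed
  define c where "c = map (code F) [1..<Suc n]"
  have c: "length c = n" "\<And>i. i < n \<Longrightarrow> c ! i = code F (Suc i)"
    by (auto simp: c_def simp del: upt_Suc)
  have "padded_comp n c"
    unfolding padded_comp_def
  proof (intro conjI allI impI)
    fix i j assume "i < j \<and> j < n \<and> 0 < c ! i"
    then show "0 < c ! j"
      using climb[of "Suc i" "Suc j"] c by auto
  qed (rule c)
  moreover have "forest_of_comp c = F"
    by (rule forest_of_comp_eqI) (use F(1) c zero in auto)
  ultimately show "F \<in> forest_of_comp ` {c. padded_comp n c}" by blast
next
  fix F assume "F \<in> forest_of_comp ` {c. padded_comp n c}"
  then show "F \<in> Zigzag n"
    by (auto simp: Zigzag_def is_forest_of_comp Qdes_forest_of_comp)
qed

subsection \<open>Substituting parameter sequences for t\<close>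

definition param_seq :: "(nat \<Rightarrow> mpoly) \<Rightarrow> bool" where
  "param_seq s \<longleftrightarrow> (\<forall>i\<ge>1. s i \<in> params)"

definition tsub :: "(nat \<Rightarrow> mpoly) \<Rightarrow> mpoly \<Rightarrow> mpoly" where
  "tsub s = subst (\<lambda>v. case v of X j \<Rightarrow> Var (X j) | T j \<Rightarrow> s j)"

definition xsub :: "(nat \<Rightarrow> mpoly) \<Rightarrow> mpoly \<Rightarrow> mpoly" where
  "xsub s = subst (\<lambda>v. case v of X j \<Rightarrow> s j | T j \<Rightarrow> Var (T j))"

definition skip :: "nat \<Rightarrow> (nat \<Rightarrow> mpoly) \<Rightarrow> nat \<Rightarrow> mpoly" where
  "skip i s = (\<lambda>j. if j < i then s j else s (Suc j))"

abbreviation tvar :: "nat \<Rightarrow> mpoly" where "tvar \<equiv> \<lambda>i. Var (T i)"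

lemma param_seqD: "param_seq s \<Longrightarrow> i \<ge> 1 \<Longrightarrow> s i \<in> params"
  by (simp add: param_seq_def)

lemma param_seq_tvar [simp]: "param_seq tvar"
  by (simp add: param_seq_def)

lemma param_seq_skip: "param_seq s \<Longrightarrow> param_seq (skip i s)"
  by (auto simp: param_seq_def skip_def)

lemma tsub_simps [simp]:
  "tsub s (p + q) = tsub s p + tsub s q" "tsub s (p - q) = tsub s p - tsub s q"
  "tsub s (p * q) = tsub s p * tsub s q" "tsub s 0 = 0" "tsub s 1 = 1"
  "tsub s (Var (X j)) = Var (X j)" "tsub s (Var (T j)) = s j"
  by (simp_all add: tsub_def)

lemma xsub_simps [simp]:
  "xsub s (p + q) = xsub s p + xsub s q" "xsub s (p - q) = xsub s p - xsub s q"
  "xsub s (p * q) = xsub s p * xsub s q" "xsub s 0 = 0" "xsub s 1 = 1"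
  "xsub s (Var (X j)) = s j" "xsub s (Var (T j)) = Var (T j)"
  "xsub s (sum f A) = (\<Sum>x\<in>A. xsub s (f x))"
  by (simp_all add: xsub_def)

lemma tsub_tvar [simp]: "tsub tvar p = p"
  unfolding tsub_def by (rule subst_id_on) (simp split: var.split)

lemma that_tsub: "that i = tsub (skip i tvar)"
  unfolding that_def tsub_def skip_def
  by (intro arg_cong[where f=subst] ext) (simp split: var.split)

lemma eval_tt_xsub: "eval_tt = xsub tvar"
  by (simp add: eval_tt_def xsub_def)

lemma xsub_Zt [simp]: "a \<in> Zt \<Longrightarrow> xsub s a = a"
  unfolding xsub_def by (rule subst_id_on) (auto simp: Zt_def)

text \<open>Hats are absorbed into the sequence, so iterated E_i never stack up
  substitutions.\<close>

lemma tsub_that: "tsub s (that i p) = tsub (skip i s) p"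
proof -
  have "tsub s (that i p) = subst (\<lambda>v. tsub s (that i (Var v))) p"
    by (simp add: that_tsub tsub_def subst_subst)
  also have "\<dots> = tsub (skip i s) p"
    unfolding tsub_def that_tsub skip_def by (intro subst_cong) (auto split: var.split)
  finally show ?thesis .
qed

lemma skip_skip: "j < i \<Longrightarrow> skip j (skip i s) = skip (i - 1) (skip j s)"
  by (auto simp: skip_def fun_eq_iff)

lemma Pos_tsub: "p \<in> Pos \<Longrightarrow> param_seq s \<Longrightarrow> tsub s p \<in> Pos"
  unfolding tsub_def
proof (erule poly_ring_subst)
  fix v assume "param_seq s" "v \<in> pos_set"
  then show "(case v of X j \<Rightarrow> Var (X j) | T j \<Rightarrow> s j) \<in> Pos"
    using params_Pos[OF param_seqD, of s] by (cases v) (auto simp: pos_set_def)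
qed

lemma xsub_in_Zt: "p \<in> Pos \<Longrightarrow> param_seq s \<Longrightarrow> xsub s p \<in> Zt"
  unfolding xsub_def Zt_eq
proof (erule poly_ring_subst)
  fix v assume "param_seq s" "v \<in> pos_set"
  then show "(case v of X j \<Rightarrow> s j | T j \<Rightarrow> Var (T j)) \<in> poly_ring {T i | i. i \<ge> 1}"
    using params_Zt[OF param_seqD, of s, unfolded Zt_eq] by (cases v) (auto simp: pos_set_def)
qed

text \<open>Positivity of the indices ensures that each substituted s_j is a parameter and hence
  fixed by the insertion.\<close>

lemma tsub_ins:
  assumes "p \<in> Pos" "param_seq s" "i \<ge> 1"
  shows "tsub s (ins k (Var (T i)) p) = ins k (s i) (tsub s p)"
proof -
  have "tsub s (ins k (Var (T i)) p) = subst (\<lambda>v. tsub s (ins k (Var (T i)) (Var v))) p"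
    by (simp add: ins_def tsub_def subst_subst)
  also have "\<dots> = subst (\<lambda>v. ins k (s i) (tsub s (Var v))) p"
  proof (rule subst_cong)
    fix v assume "v \<in> vars p"
    then have "v \<in> pos_set" using assms(1) by (auto simp: poly_ring_def)
    then show "tsub s (ins k (Var (T i)) (Var v)) = ins k (s i) (tsub s (Var v))"
      using assms(2) by (auto simp: pos_set_def param_seq_def)
  qed
  also have "\<dots> = ins k (s i) (tsub s p)"
    by (simp add: ins_def tsub_def subst_subst)
  finally show ?thesis .
qed

lemma E_tsub:
  assumes "p \<in> Pos" "param_seq s" "i \<ge> 1"
  shows "E i (s i) (tsub s p) = tsub s (E i (Var (T i)) p)"
proof (rule E_eqI)
  have "(Var (X i) - s i) * tsub s (E i (Var (T i)) p)
      = tsub s ((Var (X i) - Var (T i)) * E i (Var (T i)) p)" by simp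
  also have "\<dots> = ins (Suc i) (s i) (tsub s p) - ins i (s i) (tsub s p)"
    using assms by (simp add: E_eq tsub_ins)
  finally show "(Var (X i) - s i) * tsub s (E i (Var (T i)) p)
      = ins (Suc i) (s i) (tsub s p) - ins i (s i) (tsub s p)" .
qed (use assms in \<open>simp add: param_seq_def\<close>)

text \<open>Both sides send x_j and t_j to s_j; this carries the normalisation at x = t over to
  arbitrary s.\<close>

lemma xsub_tsub:
  assumes "p \<in> Pos" "param_seq s"
  shows "xsub s (tsub s p) = tsub s (eval_tt p)"
proof -
  have "xsub s (tsub s p) = subst (\<lambda>v. xsub s (tsub s (Var v))) p"
    by (simp add: xsub_def tsub_def subst_subst)
  also have "\<dots> = subst (\<lambda>v. tsub s (eval_tt (Var v))) p"
  proof (rule subst_cong)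
    fix v assume "v \<in> vars p"
    then have "v \<in> pos_set" using assms(1) by (auto simp: poly_ring_def)
    then show "xsub s (tsub s (Var v)) = tsub s (eval_tt (Var v))"
      using assms(2) by (auto simp: pos_set_def param_seq_def eval_tt_xsub params_Zt)
  qed
  also have "\<dots> = tsub s (eval_tt p)"
    by (simp add: eval_tt_xsub xsub_def tsub_def subst_subst)
  finally show ?thesis .
qed

text \<open>A polynomial killed by all E_i lies in \<int>[t], where evaluating x changes nothing.
  Identities of double forest polynomials are proved by applying this to a difference.\<close>

lemma zero_if_E_xsub_zero:
  assumes "f \<in> Pos" "param_seq s" "\<And>i. i \<ge> 1 \<Longrightarrow> E i (s i) f = 0" "xsub s f = 0"
  shows "f = 0"
proof -
  have "f \<in> Zt" by (rule E_zero_imp_Zt) (use assms in \<open>auto simp: param_seq_def\<close>)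
  then show ?thesis using assms(4) by simp
qed

subsection \<open>Existence and uniqueness of double forest polynomials\<close>

text \<open>A Poincare lemma: the commutation relations are the only obstruction to solving
  \<open>E\<^sub>i f = g\<^sub>i\<close>. Subtracting \<open>(x\<^sub>N - t\<^sub>N) g\<^sub>N\<close> from \<open>f\<close> kills the last nonzero
  \<open>g\<^sub>N\<close> without disturbing compatibility.\<close>
lemma E_integrate:
  assumes "\<And>i. i \<ge> 1 \<Longrightarrow> g i \<in> Pos" "\<And>i. i \<ge> 1 \<Longrightarrow> g i \<in> homog d" "\<And>i. i > N \<Longrightarrow> g i = 0"
    and "\<And>i j. 1 \<le> j \<Longrightarrow> Suc j < i \<Longrightarrow> E j (Var (T j)) (g i) = E (i - 1) (Var (T i)) (g j)"
  shows "\<exists>f. f \<in> Pos \<and> f \<in> homog (Suc d) \<and> (\<forall>i\<ge>1. E i (Var (T i)) f = g i)"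
  using assms
proof (induction N arbitrary: g)
  case 0
  then show ?case by (intro exI[of _ 0]) simp
next
  case (Suc N)
  define M where "M = Suc N"
  have M: "M \<ge> 1" by (simp add: M_def)
  \<comment> \<open>For j > M the relation for the pair (M, j + 1) equates E_j of g_M, taken at
    t_{j+1}, with E_M of g_{j+1} = 0. So g_M involves only x_1, ..., x_M.\<close>
  have gM: "g M \<in> Zt_xn M"
  proof (rule E_zero_imp_Zt_xn[where u = "\<lambda>j. Var (T (Suc j))"])
    show "g M \<in> Pos" using Suc.prems(1) M by blast
    fix j assume j: "j > M"
    show "Var (T (Suc j)) \<in> params" by simp
    have "E j (Var (T (Suc j))) (g M) = E M (Var (T M)) (g (Suc j))"
      using Suc.prems(4)[of M "Suc j"] j M by simp
    also have "g (Suc j) = 0" using Suc.prems(3) j by (simp add: M_def)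
    finally show "E j (Var (T (Suc j))) (g M) = 0" using M by simp
  qed
  define f0 where "f0 = (Var (X M) - Var (T M)) * g M"
  have "Var (X M) - Var (T M) \<in> Zt_xn M"
    unfolding Zt_xn_eq using M by (intro poly_ring_diff) auto
  then have f0: "f0 \<in> Zt_xn M"
    using gM unfolding f0_def Zt_xn_eq by (rule poly_ring_mult)
  have f0P: "f0 \<in> Pos" by (rule Zt_xn_Pos[OF f0])
  have f0H: "f0 \<in> homog (Suc d)"
    using homog_mult[OF homog_diff[OF homog_Var homog_Var] Suc.prems(2)[OF M]]
    by (simp add: f0_def)
  \<comment> \<open>Insertion at M + 1 misses all variables of f0, and insertion at M kills the
    factor x_M - t_M.\<close>
  have EM: "E M (Var (T M)) f0 = g M"
  proof (rule E_eqI)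
    have "ins (Suc M) (Var (T M)) f0 = f0" by (rule ins_low[OF f0]) simp
    moreover have "ins M (Var (T M)) f0 = 0" by (simp add: f0_def)
    ultimately show "(Var (X M) - Var (T M)) * g M = ins (Suc M) (Var (T M)) f0 - ins M (Var (T M)) f0"
      by (simp only: diff_zero) (simp only: f0_def)
  qed (use M in simp)
  define g' where "g' i = g i - E i (Var (T i)) f0" for i
  have "\<exists>f. f \<in> Pos \<and> f \<in> homog (Suc d) \<and> (\<forall>i\<ge>1. E i (Var (T i)) f = g' i)"
  proof (rule Suc.IH)
    fix i :: nat assume i: "i \<ge> 1"
    show "g' i \<in> Pos" using Suc.prems(1)[OF i] f0P i by (auto simp: g'_def E_Pos)
    show "g' i \<in> homog d"
      using Suc.prems(2)[OF i] f0P f0H i by (auto simp: g'_def E_homog intro: homog_diff)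
  next
    fix i assume "i > N"
    then consider "i = M" | "i > M" unfolding M_def by linarith
    then show "g' i = 0"
    proof cases
      case 2
      then show ?thesis
        using Suc.prems(3)[of i] E_low[OF _ _ f0] by (simp add: g'_def M_def)
    qed (simp add: g'_def EM)
  next
    fix i j :: nat assume j: "1 \<le> j" "Suc j < i"
    have "E j (Var (T j)) (g' i) = E j (Var (T j)) (g i) - E j (Var (T j)) (E i (Var (T i)) f0)"
      using Suc.prems(1)[of i] f0P j by (simp add: g'_def E_diff E_Pos)
    also have "\<dots> = E (i - 1) (Var (T i)) (g j) - E (i - 1) (Var (T i)) (E j (Var (T j)) f0)"
      using Suc.prems(4)[OF j] E_commute[OF j, of "Var (T j)" "Var (T i)" f0] f0P j by simp
    also have "\<dots> = E (i - 1) (Var (T i)) (g' j)"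
      using Suc.prems(1)[of j] f0P j by (simp add: g'_def E_diff E_Pos)
    finally show "E j (Var (T j)) (g' i) = E (i - 1) (Var (T i)) (g' j)" .
  qed
  then obtain f' where f': "f' \<in> Pos" "f' \<in> homog (Suc d)" "\<And>i. i \<ge> 1 \<Longrightarrow> E i (Var (T i)) f' = g' i"
    by blast
  have "E i (Var (T i)) (f0 + f') = g i" if "i \<ge> 1" for i
    using that f' f0P by (simp add: E_add g'_def)
  then show ?case
    using f0P f0H f' by (intro exI[of _ "f0 + f'"]) (auto simp: homog_add)
qed

text \<open>The polynomials of the forests F/i enter as a separate argument Q, so existence can be
  treated one forest at a time.\<close>

definition dfp_spec :: "forest \<Rightarrow> (nat \<Rightarrow> mpoly) \<Rightarrow> mpoly \<Rightarrow> bool" where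
  "dfp_spec F Q p \<longleftrightarrow> p \<in> Pos \<and> p \<in> homog (fsize F)
     \<and> eval_tt p = (if F = empty_forest then 1 else 0)
     \<and> (\<forall>i\<ge>1. E i (Var (T i)) p = (if i \<in> Qdes F then that i (Q i) else 0))"

text \<open>The test i \<in> Qdes F around the recursive call supplies the decrease of
  \<open>fsize\<close> for termination.\<close>

function dfp_family :: "forest \<Rightarrow> mpoly" where
  "dfp_family F = (if is_forest F
     then SOME p. dfp_spec F (\<lambda>i. if i \<in> Qdes F then dfp_family (fdel F i) else 0) p else 0)"
  by auto
termination
  by (relation "measure fsize") (auto simp: fsize_fdel)

declare dfp_family.simps [simp del]

lemma dfp_spec_exists:
  assumes "is_forest F"
    and IH: "\<And>i. i \<in> Qdes F \<Longrightarrow> dfp_spec (fdel F i) (\<lambda>j. P (fdel (fdel F i) j)) (P (fdel F i))"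
  shows "\<exists>p. dfp_spec F (\<lambda>i. P (fdel F i)) p"
proof (cases "F = empty_forest")
  case True
  have "E i (Var (T i)) 1 = 0" if "i \<ge> 1" for i
    using that by (intro E_Zt) (auto simp: Zt_eq)
  then have "dfp_spec F (\<lambda>i. P (fdel F i)) 1"
    by (auto simp: dfp_spec_def True eval_tt_xsub fsize_def empty_forest_def Qdes_def)
  then show ?thesis by blast
next
  case False
  define g where "g i = (if i \<in> Qdes F then that i (P (fdel F i)) else 0)" for i
  obtain i0 where i0: "i0 \<in> Qdes F" by (rule Qdes_nonempty[OF False])
  define d where "d = fsize (fdel F i0)"
  have d: "fsize (fdel F i) = d" if "i \<in> Qdes F" for i
    using fsize_fdel[OF assms(1) that] fsize_fdel[OF assms(1) i0] by (simp add: d_def)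
  have Fd: "fsize F = Suc d"
    using fsize_fdel[OF assms(1) i0] by (simp add: d_def)
  have IHP: "P (fdel F i) \<in> Pos" "P (fdel F i) \<in> homog d"
    and IHE: "\<And>j. j \<ge> 1 \<Longrightarrow> E j (Var (T j)) (P (fdel F i))
        = (if j \<in> Qdes (fdel F i) then that j (P (fdel (fdel F i) j)) else 0)"
    if "i \<in> Qdes F" for i
    using IH[OF that] d[OF that] by (auto simp: dfp_spec_def)
  obtain N where N: "\<And>i. i \<in> Qdes F \<Longrightarrow> i \<le> N"
    using Qdes_bounded[OF assms(1)] by blast
  have "\<exists>f. f \<in> Pos \<and> f \<in> homog (Suc d) \<and> (\<forall>i\<ge>1. E i (Var (T i)) f = g i)"
  proof (rule E_integrate)
    fix i :: nat assume "i \<ge> 1"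
    show "g i \<in> Pos"
      using IHP[of i] by (auto simp: g_def that_tsub intro!: Pos_tsub param_seq_skip)
    show "g i \<in> homog d"
      using IHP[of i] by (auto simp: g_def that_def intro!: homog_subst split: var.split)
  next
    fix i assume "i > N"
    then show "g i = 0" using N[of i] by (auto simp: g_def)
  next
    fix i j :: nat assume j: "1 \<le> j" "Suc j < i"
    let ?A = "i \<in> Qdes F \<and> j \<in> Qdes (fdel F i)" and ?B = "j \<in> Qdes F \<and> i - 1 \<in> Qdes (fdel F j)"
    have L: "E j (Var (T j)) (g i) = (if ?A then that i (that j (P (fdel (fdel F i) j))) else 0)"
    proof (cases "i \<in> Qdes F")
      case True
      have "E j (Var (T j)) (g i) = E j (skip i tvar j) (tsub (skip i tvar) (P (fdel F i)))"
      proof -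
        have "skip i tvar j = Var (T j)" using j by (simp add: skip_def)
        then show ?thesis using True by (simp add: g_def that_tsub)
      qed
      also have "\<dots> = that i (E j (Var (T j)) (P (fdel F i)))"
        using IHP[OF True] j by (simp add: E_tsub param_seq_skip that_tsub)
      finally show ?thesis using True IHE[OF True j(1)] by (simp add: that_tsub)
    qed (use j in \<open>simp add: g_def\<close>)
    have R: "E (i - 1) (Var (T i)) (g j)
        = (if ?B then that j (that (i - 1) (P (fdel (fdel F j) (i - 1)))) else 0)"
    proof (cases "j \<in> Qdes F")
      case True
      have "E (i - 1) (Var (T i)) (g j)
          = E (i - 1) (skip j tvar (i - 1)) (tsub (skip j tvar) (P (fdel F j)))"
      proof -
        \<comment> \<open>Entry i - 1 of the alphabet without t_j is t_i, exactly the parameter on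
          the right of the commutation relation.\<close>
        have "skip j tvar (i - 1) = Var (T i)" using j by (auto simp: skip_def)
        then show ?thesis using True by (simp add: g_def that_tsub)
      qed
      also have "\<dots> = that j (E (i - 1) (Var (T (i - 1))) (P (fdel F j)))"
        using IHP[OF True] j by (simp add: E_tsub param_seq_skip that_tsub)
      finally show ?thesis using True IHE[OF True, of "i - 1"] j by (simp add: that_tsub)
    qed (use j in \<open>simp add: g_def\<close>)
    have "that i (that j p) = that j (that (i - 1) p)" for p
    proof -
      have "that i (that j p) = tsub (skip j (skip i tvar)) p"
        using tsub_that[of "skip i tvar" j p] by (simp flip: that_tsub)
      also have "\<dots> = tsub (skip (i - 1) (skip j tvar)) p"
        using j by (simp add: skip_skip)
      also have "\<dots> = that j (that (i - 1) p)"
        using tsub_that[of "skip j tvar" "i - 1" p] by (simp flip: that_tsub)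
      finally show ?thesis .
    qed
    then show "E j (Var (T j)) (g i) = E (i - 1) (Var (T i)) (g j)"
      unfolding L R using Qdes_fdel_swap[OF j, of F] fdel_swap[OF j assms(1)] by auto
  qed
  then obtain f where f: "f \<in> Pos" "f \<in> homog (Suc d)" "\<And>i. i \<ge> 1 \<Longrightarrow> E i (Var (T i)) f = g i"
    by blast
  \<comment> \<open>The subtracted value lies in \<int>[t], so it fixes the normalisation without
    changing any E_i.\<close>
  define p where "p = f - eval_tt f"
  have tt: "eval_tt f \<in> Zt" using f(1) by (simp add: eval_tt_xsub xsub_in_Zt)
  have "eval_tt f \<in> homog (Suc d)"
    unfolding eval_tt_def by (rule homog_subst[OF f(2)]) (simp split: var.split)
  then have "p \<in> homog (Suc d)" using f(2) by (auto simp: p_def intro: homog_diff)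
  moreover have "E i (Var (T i)) p = g i" if "i \<ge> 1" for i
    using that f tt by (simp add: p_def E_diff Zt_Pos E_Zt)
  moreover have "eval_tt p = 0" using tt by (simp add: p_def eval_tt_xsub)
  moreover have "p \<in> Pos" using f tt by (auto simp: p_def Zt_Pos)
  ultimately have "dfp_spec F (\<lambda>i. P (fdel F i)) p"
    using False by (auto simp: dfp_spec_def Fd g_def)
  then show ?thesis by blast
qed

lemma dfp_family_spec:
  assumes "is_forest F"
  shows "dfp_spec F (\<lambda>i. dfp_family (fdel F i)) (dfp_family F)"
  using assms
proof (induction "fsize F" arbitrary: F rule: less_induct)
  case less
  have cong: "dfp_spec F (\<lambda>i. if i \<in> Qdes F then dfp_family (fdel F i) else 0)
      = dfp_spec F (\<lambda>i. dfp_family (fdel F i))"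
    by (auto simp: dfp_spec_def fun_eq_iff)
  have "\<exists>p. dfp_spec F (\<lambda>i. dfp_family (fdel F i)) p"
  proof (rule dfp_spec_exists[OF less.prems])
    fix i assume "i \<in> Qdes F"
    then have "fsize (fdel F i) < fsize F" using fsize_fdel[OF less.prems] by simp
    then show "dfp_spec (fdel F i) (\<lambda>j. dfp_family (fdel (fdel F i) j)) (dfp_family (fdel F i))"
      by (rule less.hyps) (rule is_forest_fdel[OF less.prems])
  qed
  then show ?case
    unfolding dfp_family.simps[of F] cong using less.prems by (simp add: someI_ex)
qed

lemma dfp_char_unique:
  assumes "dfp_char P" "dfp_char Q" "is_forest F"
  shows "P F = Q F"
  using assms(3)
proof (induction "fsize F" arbitrary: F rule: less_induct)
  case less
  have P: "P F \<in> Pos" "eval_tt (P F) = (if F = empty_forest then 1 else 0)"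
    "\<And>i. i \<ge> 1 \<Longrightarrow> E i (Var (T i)) (P F) = (if i \<in> Qdes F then that i (P (fdel F i)) else 0)"
    using assms(1) less.prems by (auto simp: dfp_char_def pos_vars_eq Eop_E)
  have Q: "Q F \<in> Pos" "eval_tt (Q F) = (if F = empty_forest then 1 else 0)"
    "\<And>i. i \<ge> 1 \<Longrightarrow> E i (Var (T i)) (Q F) = (if i \<in> Qdes F then that i (Q (fdel F i)) else 0)"
    using assms(2) less.prems by (auto simp: dfp_char_def pos_vars_eq Eop_E)
  have "P (fdel F i) = Q (fdel F i)" if "i \<in> Qdes F" for i
    using less.hyps[OF _ is_forest_fdel] fsize_fdel[OF less.prems that] less.prems by simp
  then have "E i (Var (T i)) (P F - Q F) = 0" if "i \<ge> 1" for i
    using that P Q by (simp add: E_diff)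
  moreover have "xsub tvar (P F - Q F) = 0"
    using P(2) Q(2) by (simp add: eval_tt_xsub)
  ultimately have "P F - Q F = 0"
    using zero_if_E_xsub_zero[OF poly_ring_diff[OF P(1) Q(1)] param_seq_tvar] by blast
  then show ?case by simp
qed

lemma dfp_char_dfp: "dfp_char dfp"
proof -
  have fam: "dfp_char dfp_family"
    using dfp_family_spec
    by (auto simp: dfp_char_def dfp_spec_def homogeneous_iff pos_vars_eq Eop_E)
  have "dfp_char dfp \<and> (\<forall>F. \<not> is_forest F \<longrightarrow> dfp F = 0)"
    unfolding dfp_def
  proof (rule theI[of _ dfp_family])
    show "dfp_char dfp_family \<and> (\<forall>F. \<not> is_forest F \<longrightarrow> dfp_family F = 0)"
      using fam by (simp add: dfp_family.simps)
    fix P assume "dfp_char P \<and> (\<forall>F. \<not> is_forest F \<longrightarrow> P F = 0)"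
    then show "P = dfp_family"
      using dfp_char_unique[OF _ fam] by (auto simp: fun_eq_iff dfp_family.simps)
  qed
  then show ?thesis by blast
qed

subsection \<open>The double forest polynomials form a basis\<close>

definition dfps :: "(nat \<Rightarrow> mpoly) \<Rightarrow> forest \<Rightarrow> mpoly" where
  "dfps s F = tsub s (dfp F)"

lemma dfps_tvar: "dfps tvar F = dfp F"
  by (simp add: dfps_def)

lemma dfp_Pos: "is_forest F \<Longrightarrow> dfp F \<in> Pos"
  using dfp_char_dfp by (simp add: dfp_char_def pos_vars_eq)

lemma dfps_Pos: "is_forest F \<Longrightarrow> param_seq s \<Longrightarrow> dfps s F \<in> Pos"
  by (simp add: dfps_def dfp_Pos Pos_tsub)

text \<open>The recursion for all parameter sequences at once, closed under further applications of
  the operators.\<close>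

lemma E_dfps:
  assumes "is_forest F" "param_seq s" "i \<ge> 1"
  shows "E i (s i) (dfps s F) = (if i \<in> Qdes F then dfps (skip i s) (fdel F i) else 0)"
proof -
  have "E i (Var (T i)) (dfp F) = (if i \<in> Qdes F then that i (dfp (fdel F i)) else 0)"
    using dfp_char_dfp assms by (simp add: dfp_char_def Eop_E)
  then show ?thesis
    using assms by (simp add: dfps_def E_tsub dfp_Pos tsub_that)
qed

lemma xsub_dfps:
  assumes "is_forest F" "param_seq s"
  shows "xsub s (dfps s F) = (if F = empty_forest then 1 else 0)"
  using dfp_char_dfp assms by (simp add: dfps_def xsub_tsub dfp_Pos dfp_char_def)

lemma dfps_empty: "param_seq s \<Longrightarrow> dfps s empty_forest = 1"
proof -
  assume s: "param_seq s"
  have "dfps s empty_forest - 1 = 0"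
  proof (rule zero_if_E_xsub_zero[OF _ s])
    show "dfps s empty_forest - 1 \<in> Pos" using dfps_Pos[OF is_forest_empty s] by auto
    show "xsub s (dfps s empty_forest - 1) = 0" using xsub_dfps[OF is_forest_empty s] by simp
    fix i :: nat assume i: "i \<ge> 1"
    have "E i (s i) 1 = 0" using param_seqD[OF s i] i by (intro E_Zt) (auto simp: Zt_eq)
    then show "E i (s i) (dfps s empty_forest - 1) = 0"
      using E_dfps[OF is_forest_empty s i] i s param_seqD[OF s i] dfps_Pos[OF is_forest_empty s]
      by (simp add: E_diff)
  qed
  then show ?thesis by simp
qed

section \<open>Linear independence over \<int>[t]\<close>

lemma E_sum_dfps:
  assumes "finite S" "\<And>F. F \<in> S \<Longrightarrow> is_forest F" "\<And>F. F \<in> S \<Longrightarrow> a F \<in> Zt" "param_seq s" "i \<ge> 1"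
  shows "E i (s i) (\<Sum>F\<in>S. a F * dfps s F)
    = (\<Sum>F\<in>{F\<in>S. i \<in> Qdes F}. a F * dfps (skip i s) (fdel F i))"
proof -
  note si = param_seqD[OF assms(4,5)] assms(5)
  have "E i (s i) (\<Sum>F\<in>S. a F * dfps s F) = (\<Sum>F\<in>S. E i (s i) (a F * dfps s F))"
    by (rule E_sum[OF si]) (use assms in \<open>auto simp: dfps_Pos Zt_Pos\<close>)
  also have "\<dots> = (\<Sum>F\<in>S. if i \<in> Qdes F then a F * dfps (skip i s) (fdel F i) else 0)"
    using assms by (intro sum.cong) (auto simp: E_scale[OF si] dfps_Pos E_dfps)
  also have "\<dots> = (\<Sum>F\<in>{F\<in>S. i \<in> Qdes F}. a F * dfps (skip i s) (fdel F i))"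
    using assms(1) by (simp add: sum.inter_filter)
  finally show ?thesis .
qed

text \<open>Deletion at i is injective where it applies, with \<open>fins\<close> as inverse, so no
  two coefficients merge.\<close>

lemma sum_dfps_fdel:
  assumes "i \<ge> 1"
  shows "(\<Sum>F\<in>{F\<in>S. i \<in> Qdes F}. a F * dfps u (fdel F i))
    = (\<Sum>G\<in>(\<lambda>F. fdel F i) ` {F\<in>S. i \<in> Qdes F}. a (fins G i) * dfps u G)"
  by (subst sum.reindex) (auto simp: inj_on_def fins_fdel dest: fdel_inject)

lemma dfps_independent:
  assumes "finite S" "\<And>F. F \<in> S \<Longrightarrow> is_forest F" "\<And>F. F \<in> S \<Longrightarrow> a F \<in> Zt" "param_seq s"
    "(\<Sum>F\<in>S. a F * dfps s F) = 0" "F \<in> S"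
  shows "a F = 0"
  using assms
proof (induction "fsize F" arbitrary: F S a s rule: less_induct)
  case less
  show ?case
  proof (cases "F = empty_forest")
    case True
    \<comment> \<open>Evaluation at x = s kills every term except that of the empty forest.\<close>
    have "0 = xsub s (\<Sum>G\<in>S. a G * dfps s G)" using less.prems(5) by simp
    also have "\<dots> = (\<Sum>G\<in>S. if G = F then a G else 0)"
      unfolding xsub_simps
    proof (rule sum.cong)
      fix G assume "G \<in> S"
      then show "xsub s (a G) * xsub s (dfps s G) = (if G = F then a G else 0)"
        using less.prems(2,3,4) True by (simp add: xsub_dfps)
    qed simp
    also have "\<dots> = a F" using less.prems by simp
    finally show ?thesis by simp
  next
    case False
    then obtain i where i: "i \<in> Qdes F" by (rule Qdes_nonempty)
    note i1 = Qdes_pos[OF i]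
    let ?S = "(\<lambda>F. fdel F i) ` {F\<in>S. i \<in> Qdes F}"
    \<comment> \<open>The unreduced application exhibits the coefficient function of the relation
      obtained by applying E_i.\<close>
    have "(\<lambda>G. a (fins G i)) (fdel F i) = 0"
    proof (rule less.hyps[where S = ?S and s = "skip i s" and F = "fdel F i"])
      show "fsize (fdel F i) < fsize F" using fsize_fdel i less.prems by simp
      show "finite ?S" using less.prems by simp
      show "is_forest G" if "G \<in> ?S" for G using that less.prems is_forest_fdel by auto
      show "a (fins G i) \<in> Zt" if "G \<in> ?S" for G using that less.prems by (auto simp: fins_fdel)
      show "param_seq (skip i s)" using less.prems param_seq_skip by blast
      show "fdel F i \<in> ?S" using i less.prems by blast
      show "(\<Sum>G\<in>?S. a (fins G i) * dfps (skip i s) G) = 0"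
        using E_sum_dfps[where a = a, OF less.prems(1-4) i1] less.prems(5) param_seqD[OF less.prems(4) i1] i1
        by (simp add: sum_dfps_fdel)
    qed
    then show ?thesis using i by (simp add: fins_fdel)
  qed
qed

text \<open>The surviving terms form a relation for the skipped alphabet, so independence there
  kills their coefficients.\<close>

lemma E_zero_imp_coeff_zero:
  assumes "finite S" "\<And>F. F \<in> S \<Longrightarrow> is_forest F" "\<And>F. F \<in> S \<Longrightarrow> a F \<in> Zt" "param_seq s"
    "i \<ge> 1" "E i (s i) (\<Sum>F\<in>S. a F * dfps s F) = 0" "F \<in> S" "i \<in> Qdes F"
  shows "a F = 0"
proof -
  let ?S = "(\<lambda>F. fdel F i) ` {F\<in>S. i \<in> Qdes F}"
  have "(\<lambda>G. a (fins G i)) (fdel F i) = 0"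
  proof (rule dfps_independent[where S = ?S and s = "skip i s" and F = "fdel F i"])
    show "finite ?S" using assms by simp
    show "is_forest G" if "G \<in> ?S" for G using that assms is_forest_fdel by auto
    show "a (fins G i) \<in> Zt" if "G \<in> ?S" for G using that assms by (auto simp: fins_fdel)
    show "param_seq (skip i s)" using assms param_seq_skip by blast
    show "fdel F i \<in> ?S" using assms by blast
    show "(\<Sum>G\<in>?S. a (fins G i) * dfps (skip i s) G) = 0"
      using E_sum_dfps[where a = a, OF assms(1-5)] assms(6) assms(5) by (simp add: sum_dfps_fdel)
  qed
  then show ?thesis using assms by (simp add: fins_fdel)
qed

section \<open>Spanning\<close>

definition dfp_span :: "(nat \<Rightarrow> mpoly) \<Rightarrow> mpoly set" where
  "dfp_span s = {p. \<exists>S a. finite S \<and> (\<forall>F\<in>S. is_forest F \<and> a F \<in> Zt) \<and> p = (\<Sum>F\<in>S. a F * dfps s F)}"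

lemma dfp_spanE:
  assumes "p \<in> dfp_span s"
  obtains S a where "finite S" "\<And>F. F \<in> S \<Longrightarrow> is_forest F" "\<And>F. F \<in> S \<Longrightarrow> a F \<in> Zt"
    "p = (\<Sum>F\<in>S. a F * dfps s F)"
  using assms unfolding dfp_span_def by blast

lemma dfp_span_add:
  assumes "p \<in> dfp_span s" "q \<in> dfp_span s"
  shows "p + q \<in> dfp_span s"
proof -
  obtain S a where S: "finite S" "\<And>F. F \<in> S \<Longrightarrow> is_forest F" "\<And>F. F \<in> S \<Longrightarrow> a F \<in> Zt"
    "p = (\<Sum>F\<in>S. a F * dfps s F)"
    using assms(1) by (rule dfp_spanE) blast
  obtain S' a' where S': "finite S'" "\<And>F. F \<in> S' \<Longrightarrow> is_forest F" "\<And>F. F \<in> S' \<Longrightarrow> a' F \<in> Zt"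
    "q = (\<Sum>F\<in>S'. a' F * dfps s F)"
    using assms(2) by (rule dfp_spanE) blast
  define b where "b F = (if F \<in> S then a F else 0) + (if F \<in> S' then a' F else 0)" for F
  have "p = (\<Sum>F\<in>S \<union> S'. (if F \<in> S then a F else 0) * dfps s F)"
    unfolding S(4) using S(1) S'(1) by (intro sum.mono_neutral_cong_left) auto
  moreover have "q = (\<Sum>F\<in>S \<union> S'. (if F \<in> S' then a' F else 0) * dfps s F)"
    unfolding S'(4) using S(1) S'(1) by (intro sum.mono_neutral_cong_left) auto
  ultimately have "p + q = (\<Sum>F\<in>S \<union> S'. b F * dfps s F)"
    by (simp add: b_def distrib_right sum.distrib)
  moreover have "b F \<in> Zt" for F
    using S(3) S'(3) by (auto simp: b_def Zt_eq)
  ultimately show ?thesis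
    unfolding dfp_span_def using S(1,2) S'(1,2)
    by (intro CollectI exI[of _ "S \<union> S'"] exI[of _ b]) auto
qed

lemma dfp_span_scaled: "is_forest F \<Longrightarrow> a \<in> Zt \<Longrightarrow> a * dfps s F \<in> dfp_span s"
  unfolding dfp_span_def by (intro CollectI exI[of _ "{F}"] exI[of _ "\<lambda>_. a"]) simp

lemma dfp_span_zero: "0 \<in> dfp_span s"
  unfolding dfp_span_def by (intro CollectI exI[of _ "{}"]) simp

lemma dfp_span_sum: "(\<And>x. x \<in> A \<Longrightarrow> f x \<in> dfp_span s) \<Longrightarrow> (\<Sum>x\<in>A. f x) \<in> dfp_span s"
  by (induction A rule: infinite_finite_induct) (auto simp: dfp_span_zero dfp_span_add)

lemma Zt_dfp_span: "a \<in> Zt \<Longrightarrow> param_seq s \<Longrightarrow> a \<in> dfp_span s"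
  using dfp_span_scaled[OF is_forest_empty, of a s] by (simp add: dfps_empty)

lemma Zt_uminus: "a \<in> Zt \<Longrightarrow> - a \<in> Zt"
  by (simp add: Zt_eq poly_ring_uminus)

text \<open>As in the integration argument, one eliminates the last variable \<open>x\<^sub>M\<close>: the expansion of
  \<open>E\<^sub>M f\<close> lifts to a combination of double forest polynomials which agrees with \<open>f\<close> up to
  a polynomial in fewer variables.\<close>
lemma dfp_span_if_E_dfp_span:
  assumes "f \<in> Zt_xn N" "param_seq s" "\<And>i. i \<ge> 1 \<Longrightarrow> E i (s i) f \<in> dfp_span (skip i s)"
  shows "f \<in> dfp_span s"
  using assms(1,3)
proof (induction N arbitrary: f)
  case 0
  then show ?case using Zt_dfp_span assms(2) by (simp add: Zt_xn_0)
next
  case (Suc N)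
  define M where "M = Suc N"
  have M: "M \<ge> 1" by (simp add: M_def)
  note sM = param_seqD[OF assms(2) M] M
  have fP: "f \<in> Pos" using Suc.prems(1) by (rule Zt_xn_Pos)
  have skipM: "param_seq (skip M s)" using assms(2) by (rule param_seq_skip)
  obtain S b where S: "finite S" "\<And>G. G \<in> S \<Longrightarrow> is_forest G" "\<And>G. G \<in> S \<Longrightarrow> b G \<in> Zt"
    "E M (s M) f = (\<Sum>G\<in>S. b G * dfps (skip M s) G)"
    using Suc.prems(2)[OF M] by (rule dfp_spanE) blast
  \<comment> \<open>Deleting at M turns \<open>fins G M\<close> back into G, so E_M h = E_M
    f.\<close>
  define h where "h = (\<Sum>G\<in>S. b G * dfps s (fins G M))"
  have ins: "is_forest (fins G M)" if "G \<in> S" for G using S(2) that is_forest_fins by blast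
  have hP: "h \<in> Pos" unfolding h_def using ins S(3) assms(2) by (auto simp: dfps_Pos Zt_Pos)
  have Eh: "E i (s i) h = (\<Sum>G\<in>S. b G * E i (s i) (dfps s (fins G M)))" if "i \<ge> 1" for i
  proof -
    note si = param_seqD[OF assms(2) that] that
    have "E i (s i) h = (\<Sum>G\<in>S. E i (s i) (b G * dfps s (fins G M)))"
      unfolding h_def by (rule E_sum[OF si]) (use ins S(3) assms(2) in \<open>auto simp: dfps_Pos Zt_Pos\<close>)
    also have "\<dots> = (\<Sum>G\<in>S. b G * E i (s i) (dfps s (fins G M)))"
      by (intro sum.cong E_scale[OF si] refl) (use ins S(3) assms(2) in \<open>auto simp: dfps_Pos\<close>)
    finally show ?thesis .
  qed
  have top: "E i (s i) (f - h) = 0" if i: "i > N" for i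
  proof -
    have i1: "i \<ge> 1" using i by simp
    note si = param_seqD[OF assms(2) i1] i1
    have "E i (s i) f = E i (s i) h"
    proof (cases "i = M")
      case True
      have "E M (s M) h = (\<Sum>G\<in>S. b G * dfps (skip M s) G)"
        unfolding Eh[OF M] using ins S(2) assms(2) M
        by (intro sum.cong) (auto simp: E_dfps Qdes_fins fdel_fins)
      then show ?thesis using S(4) True by simp
    next
      case False
      then have iM: "i > M" using i by (simp add: M_def)
      have "b G * E i (s i) (dfps s (fins G M)) = 0" if G: "G \<in> S" for G
      proof (cases "i \<in> Qdes (fins G M)")
        case True
        then have iG: "i - 1 \<in> Qdes G" "i - 1 > M"
          using Qdes_fins_above[OF S(2)[OF G] M True iM] by auto
        \<comment> \<open>Commutation gives E_{i-1} E_M f = E_M E_i f = 0, so the forests G with i -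
          1 in Qdes G have coefficient 0. Only these could contribute to E_i h.\<close>
        have "E (i - 1) (skip M s (i - 1)) (E M (s M) f) = E (i - 1) (s i) (E M (s M) f)"
          using iG by (auto simp: skip_def)
        also have "\<dots> = E M (s M) (E i (s i) f)"
          using E_commute[OF M, of i "s M" "s i" f] iG(2) sM si fP by simp
        also have "E i (s i) f = 0"
          using E_low[OF si Suc.prems(1)] iM by (simp add: M_def)
        also have "E M (s M) 0 = 0" by (rule E_zero[OF sM])
        finally have "b G = 0"
          using iG(1,2) by (intro E_zero_imp_coeff_zero[OF S(1-3) skipM _ _ G]) (auto simp: S(4))
        then show ?thesis by simp
      qed (use E_dfps[OF ins[OF G] assms(2) i1] in simp)
      then have "E i (s i) h = 0" unfolding Eh[OF i1] by (intro sum.neutral) blast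
      then show ?thesis using E_low[OF si Suc.prems(1)] iM by (simp add: M_def)
    qed
    then show ?thesis using fP hP by (simp add: E_diff[OF si])
  qed
  have "f - h \<in> dfp_span s"
  proof (rule Suc.IH)
    show "f - h \<in> Zt_xn N"
      by (rule E_zero_imp_Zt_xn[where u = s]) (use fP hP top assms(2) in \<open>auto simp: param_seq_def\<close>)
    fix i :: nat assume i: "i \<ge> 1"
    note si = param_seqD[OF assms(2) i] i
    \<comment> \<open>Each term of E_i h is 0 or a multiple of a double forest polynomial for the
      skipped alphabet, so the hypothesis on f passes to f - h.\<close>
    have "(\<Sum>G\<in>S. (- b G) * E i (s i) (dfps s (fins G M))) \<in> dfp_span (skip i s)"
    proof (rule dfp_span_sum)
      fix G assume G: "G \<in> S"
      show "(- b G) * E i (s i) (dfps s (fins G M)) \<in> dfp_span (skip i s)"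
        using dfp_span_scaled[OF is_forest_fdel[OF ins[OF G]] Zt_uminus[OF S(3)[OF G]]]
          E_dfps[OF ins[OF G] assms(2) i] dfp_span_zero by simp
    qed
    moreover have "E i (s i) (f - h)
        = E i (s i) f + (\<Sum>G\<in>S. (- b G) * E i (s i) (dfps s (fins G M)))"
      using fP hP by (simp add: E_diff[OF si] Eh[OF i] sum_negf)
    ultimately show "E i (s i) (f - h) \<in> dfp_span (skip i s)"
      using Suc.prems(2)[OF i] by (simp only: dfp_span_add)
  qed
  moreover have "h \<in> dfp_span s"
    unfolding h_def using ins S(3) by (intro dfp_span_sum dfp_span_scaled) auto
  ultimately have "(f - h) + h \<in> dfp_span s" by (rule dfp_span_add)
  then show ?case by simp
qed

text \<open>Each E_i lowers the degree and skips an entry of s, hence the induction on d for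
  arbitrary s.\<close>

lemma homog_dfp_span: "f \<in> Pos \<Longrightarrow> f \<in> homog d \<Longrightarrow> param_seq s \<Longrightarrow> f \<in> dfp_span s"
proof (induction d arbitrary: f s)
  case 0
  then obtain k where "f = of_int k" by (auto elim: homog_0E)
  then have "f \<in> Zt" by (simp add: Zt_eq)
  then show ?case using 0 by (simp add: Zt_dfp_span)
next
  case (Suc d)
  obtain N where N: "f \<in> Zt_xn N" using Pos_Zt_xn[OF Suc.prems(1)] by blast
  show ?case
  proof (rule dfp_span_if_E_dfp_span[OF N Suc.prems(3)])
    fix i :: nat assume i: "i \<ge> 1"
    note si = param_seqD[OF Suc.prems(3) i] i
    show "E i (s i) f \<in> dfp_span (skip i s)"
      using Suc.prems by (intro Suc.IH E_Pos[OF si] E_homog[OF si] param_seq_skip)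
  qed
qed

lemma Pos_dfp_span:
  assumes "f \<in> Pos" "param_seq s"
  shows "f \<in> dfp_span s"
proof -
  obtain g where g: "f = (\<Sum>m\<in>keys f. g m)" "\<And>m. m \<in> keys f \<Longrightarrow> g m \<in> Pos"
    "\<And>m. g m \<in> homog (mdeg m)"
    using poly_ring_monomial_sum[OF assms(1)] by blast
  have "(\<Sum>m\<in>keys f. g m) \<in> dfp_span s"
    using g(2,3) assms(2) by (intro dfp_span_sum homog_dfp_span)
  then show ?thesis using g(1) by simp
qed

text \<open>A coincidence would be a relation with coefficients 1 and -1. Injectivity is needed
  because a basis is here a set of polynomials.\<close>

lemma inj_on_dfp: "inj_on dfp (Collect is_forest)"
proof (rule inj_onI, rule ccontr)
  fix F G assume F: "F \<in> Collect is_forest" "G \<in> Collect is_forest" "dfp F = dfp G" "F \<noteq> G"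
  let ?a = "\<lambda>H. if H = F then 1 else -1 :: mpoly"
  have "?a F = 0"
    by (rule dfps_independent[where S = "{F, G}" and s = tvar])
       (use F in \<open>auto simp: dfps_tvar Zt_eq\<close>)
  then show False by simp
qed

subsection \<open>The basis of equivariantly quasisymmetric polynomials\<close>

text \<open>For i < n, E_i f = 0 is the quasisymmetry condition; for i > n it expresses the absence
  of x_i. Both become one vanishing condition.\<close>

lemma EQSym_iff:
  "f \<in> EQSym n \<longleftrightarrow> f \<in> Pos \<and> (\<forall>i\<ge>1. i \<noteq> n \<longrightarrow> E i (Var (T i)) f = 0)"
proof (intro iffI conjI allI impI)
  assume f: "f \<in> EQSym n"
  then have fn: "f \<in> Zt_xn n" by (simp add: EQSym_def)
  then show P: "f \<in> Pos" by (rule Zt_xn_Pos)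
  fix i :: nat assume i: "i \<ge> 1" "i \<noteq> n"
  then consider "i < n" | "i > n" by linarith
  then show "E i (Var (T i)) f = 0"
  proof cases
    case 1
    then show ?thesis
      using f P i by (simp add: EQSym_def Rplus_ins Rminus_ins E_eq_0_iff)
  next
    case 2
    then show ?thesis using E_low[OF _ _ fn] i by simp
  qed
next
  assume f: "f \<in> Pos \<and> (\<forall>i\<ge>1. i \<noteq> n \<longrightarrow> E i (Var (T i)) f = 0)"
  have "f \<in> Zt_xn n"
    by (rule E_zero_imp_Zt_xn[where u = tvar]) (use f in auto)
  moreover have "Rplus i f = Rminus i f" if "1 \<le> i" "i < n" for i
    using f that by (simp add: Rplus_ins Rminus_ins E_eq_0_iff[symmetric])
  ultimately show "f \<in> EQSym n" by (simp add: EQSym_def)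
qed

lemma dfp_Zigzag_EQSym: "F \<in> Zigzag n \<Longrightarrow> dfp F \<in> EQSym n"
  using E_dfps[OF _ param_seq_tvar] dfp_Pos by (auto simp: EQSym_iff Zigzag_def dfps_tvar)

lemma EQSym_expansion:
  assumes "f \<in> EQSym n"
  obtains S a where "finite S" "S \<subseteq> Zigzag n" "\<And>F. F \<in> S \<Longrightarrow> a F \<in> Zt" "f = (\<Sum>F\<in>S. a F * dfp F)"
proof -
  have f: "f \<in> Pos" "\<And>i. i \<ge> 1 \<Longrightarrow> i \<noteq> n \<Longrightarrow> E i (Var (T i)) f = 0"
    using assms by (auto simp: EQSym_iff)
  obtain S a where S: "finite S" "\<And>F. F \<in> S \<Longrightarrow> is_forest F" "\<And>F. F \<in> S \<Longrightarrow> a F \<in> Zt"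
    "f = (\<Sum>F\<in>S. a F * dfps tvar F)"
    using Pos_dfp_span[OF f(1) param_seq_tvar] by (rule dfp_spanE) blast
  have "a F = 0" if F: "F \<in> S" "F \<notin> Zigzag n" for F
  proof -
    obtain i where i: "i \<in> Qdes F" "i \<noteq> n"
      using F S(2) by (auto simp: Zigzag_def)
    show ?thesis
      by (rule E_zero_imp_coeff_zero[OF S(1-3) param_seq_tvar Qdes_pos[OF i(1)] _ F(1) i(1)])
         (use f(2)[OF Qdes_pos[OF i(1)] i(2)] S(4) in simp_all)
  qed
  then have "f = (\<Sum>F\<in>S \<inter> Zigzag n. a F * dfp F)"
    unfolding S(4) dfps_tvar using S(1) by (intro sum.mono_neutral_right) auto
  then show ?thesis using that[of "S \<inter> Zigzag n" a] S(1,3) by auto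
qed

lemma Zigzag_basis: "Zt_basis (dfp ` Zigzag n) (EQSym n)"
  unfolding Zt_basis_def
proof (intro conjI ballI)
  let ?B = "dfp ` Zigzag n"
  show "?B \<subseteq> EQSym n" using dfp_Zigzag_EQSym by blast
  have forest: "F \<in> Zigzag n \<Longrightarrow> is_forest F" for F by (simp add: Zigzag_def)
  then have inj: "inj_on dfp (Zigzag n)" by (intro inj_on_subset[OF inj_on_dfp]) auto
  fix f assume f: "f \<in> EQSym n"
  obtain S a where S: "finite S" "S \<subseteq> Zigzag n" "\<And>F. F \<in> S \<Longrightarrow> a F \<in> Zt" "f = (\<Sum>F\<in>S. a F * dfp F)"
    using EQSym_expansion[OF f] by blast
  \<comment> \<open>The coefficients are moved from forests to polynomials along the injection
    \<open>dfp\<close>.\<close>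
  define c where "c b = (if b \<in> dfp ` S then a (the_inv_into S dfp b) else 0)" for b
  have injS: "inj_on dfp S" using inj S(2) by (rule inj_on_subset)
  have cS: "c (dfp F) = a F" if "F \<in> S" for F
    using that by (simp add: c_def the_inv_into_f_f[OF injS])
  have supp: "{b. c b \<noteq> 0} \<subseteq> dfp ` S" by (auto simp: c_def)
  then have fin: "finite {b. c b \<noteq> 0}" using S(1) finite_subset by blast
  have "(\<Sum>b\<in>{b. c b \<noteq> 0}. c b * b) = (\<Sum>b\<in>dfp ` S. c b * b)"
    using supp S(1) by (intro sum.mono_neutral_left) auto
  also have "\<dots> = (\<Sum>F\<in>S. a F * dfp F)"
    using cS by (simp add: sum.reindex[OF injS])
  finally have cf: "f = (\<Sum>b\<in>{b. c b \<noteq> 0}. c b * b)" using S(4) by simp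
  show "\<exists>!a. finite {b. a b \<noteq> 0} \<and> {b. a b \<noteq> 0} \<subseteq> ?B \<and> (\<forall>b. a b \<in> Zt)
      \<and> f = (\<Sum>b\<in>{b. a b \<noteq> 0}. a b * b)"
  proof (intro ex1I[of _ c] conjI allI)
    show "finite {b. c b \<noteq> 0}" by (rule fin)
    show "{b. c b \<noteq> 0} \<subseteq> ?B" using supp S(2) by blast
    show "c b \<in> Zt" for b
    proof (cases "b \<in> dfp ` S")
      case True
      then show ?thesis using cS S(3) by auto
    qed (simp add: c_def Zt_eq)
    show "f = (\<Sum>b\<in>{b. c b \<noteq> 0}. c b * b)" by (rule cf)
  next
    fix c' assume c': "finite {b. c' b \<noteq> 0} \<and> {b. c' b \<noteq> 0} \<subseteq> ?B \<and> (\<forall>b. c' b \<in> Zt)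
      \<and> f = (\<Sum>b\<in>{b. c' b \<noteq> 0}. c' b * b)"
    have cZt: "c b \<in> Zt" for b
      using cS S(3) by (cases "b \<in> dfp ` S") (auto simp: c_def Zt_eq)
    define U where "U = {b. c b \<noteq> 0} \<union> {b. c' b \<noteq> 0}"
    have U: "finite U" "U \<subseteq> ?B" using fin c' supp S(2) by (auto simp: U_def)
    \<comment> \<open>To use independence, both expansions are pulled back to the unique zigzag
      preimages of their joint support.\<close>
    define A where "A = {F \<in> Zigzag n. dfp F \<in> U}"
    have AU: "dfp ` A = U" using U(2) by (auto simp: A_def)
    have injA: "inj_on dfp A" by (rule inj_on_subset[OF inj]) (auto simp: A_def)
    then have finA: "finite A" using U(1) AU finite_imageD by blast
    have "f = (\<Sum>b\<in>U. c b * b)"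
      unfolding cf using U(1) by (intro sum.mono_neutral_left) (auto simp: U_def)
    moreover have "f = (\<Sum>b\<in>U. c' b * b)"
      using c' U(1) by (auto simp: U_def intro!: sum.mono_neutral_left)
    ultimately have "(\<Sum>b\<in>U. (c' b - c b) * b) = 0"
      by (simp add: left_diff_distrib sum_subtractf)
    then have zero: "(\<Sum>F\<in>A. (c' (dfp F) - c (dfp F)) * dfps tvar F) = 0"
      by (simp add: sum.reindex[OF injA] dfps_tvar flip: AU)
    have "c' (dfp F) - c (dfp F) = 0" if "F \<in> A" for F
    proof (rule dfps_independent[where a = "\<lambda>F. c' (dfp F) - c (dfp F)", OF finA _ _ param_seq_tvar zero that])
      show "is_forest G" if "G \<in> A" for G using that forest by (auto simp: A_def)
      show "c' (dfp G) - c (dfp G) \<in> Zt" for G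
        using c' cZt[of "dfp G"] unfolding Zt_eq by blast
    qed
    then have "c' b = c b" if "b \<in> U" for b using that AU by force
    moreover have "c' b = c b" if "b \<notin> U" for b using that by (auto simp: U_def)
    ultimately show "c' = c" by blast
  qed
qed

subsection \<open>Specialisation at t = 0\<close>

text \<open>D holds the positions of forced strict increase. Keeping n, m and D separate from any
  composition lets them vary independently in the recursion.\<close>

definition seqs :: "nat \<Rightarrow> nat \<Rightarrow> nat set \<Rightarrow> nat list set" where
  "seqs n m D = {s. length s = m \<and> sorted s \<and> set s \<subseteq> {1..n} \<and> (\<forall>j\<in>D. s ! (j - 1) < s ! j)}"

definition seq_poly :: "nat \<Rightarrow> nat \<Rightarrow> nat set \<Rightarrow> mpoly" where
  "seq_poly n m D = (\<Sum>s\<in>seqs n m D. prod_list (map (\<lambda>x. Var (X x)) s))"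

definition psums :: "nat list \<Rightarrow> nat set" where
  "psums a = {sum_list (take k a) | k. 1 \<le> k \<and> k < length a}"

lemma fqs_seq_poly:
  "fqs n c = seq_poly n (sum_list (filter (\<lambda>k. 0 < k) c)) (psums (filter (\<lambda>k. 0 < k) c))"
proof -
  have "prod_list (map (\<lambda>x. Var (X x)) s) = (\<Prod>j<length s. Var (X (s ! j)))" for s
    by (simp add: prod.list_conv_set_nth atLeast0LessThan)
  then show ?thesis
    unfolding fqs_def Let_def seq_poly_def seqs_def psums_def by (intro sum.cong) auto
qed

lemma finite_seqs: "finite (seqs n m D)"
  by (rule finite_subset[OF _ finite_lists_length_eq[of "{1..n}" m]]) (auto simp: seqs_def)

lemma seq_poly_Zt_xn: "seq_poly n m D \<in> Zt_xn n"
proof -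
  have "prod_list (map (\<lambda>x. Var (X x)) s) \<in> Zt_xn n" if "set s \<subseteq> {1..n}" for s
    using that unfolding Zt_xn_eq by (induction s) auto
  then show ?thesis
    unfolding seq_poly_def Zt_xn_eq by (intro poly_ring_sum) (auto simp: seqs_def)
qed

lemma seq_poly_Pos: "seq_poly n m D \<in> Pos"
  by (rule Zt_xn_Pos[OF seq_poly_Zt_xn])

lemma seq_poly_0: "seq_poly n 0 {} = 1"
proof -
  have "seqs n 0 {} = {[]}" by (auto simp: seqs_def)
  then show ?thesis by (simp add: seq_poly_def)
qed

lemma map_seqs:
  assumes s: "s \<in> seqs n m D" and D: "D \<subseteq> {1..<m}" and "g ` set s \<subseteq> {1..n'}"
    and mono: "\<And>x y. x \<in> set s \<Longrightarrow> y \<in> set s \<Longrightarrow> x < y \<Longrightarrow> g x < g y"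
  shows "map g s \<in> seqs n' m D"
proof -
  have s': "length s = m" "sorted s" "\<And>j. j \<in> D \<Longrightarrow> s ! (j - 1) < s ! j"
    using s by (auto simp: seqs_def)
  have "sorted (map g s)"
    unfolding sorted_iff_nth_mono
  proof (intro allI impI)
    fix i j assume ij: "i \<le> j" "j < length (map g s)"
    then have "s ! i \<le> s ! j" using s' by (auto simp: sorted_iff_nth_mono)
    then show "map g s ! i \<le> map g s ! j"
      using ij mono[of "s ! i" "s ! j"] by (cases "s ! i = s ! j") auto
  qed
  moreover have "map g s ! (j - 1) < map g s ! j" if j: "j \<in> D" for j
  proof -
    have "j \<in> {1..<m}" using D j by blast
    then have "j < length s" "j - 1 < length s" using s' by auto
    then show ?thesis using s'(3)[OF j] mono by simp
  qed
  ultimately show ?thesis using assms(3) s' by (auto simp: seqs_def)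
qed

text \<open>Setting x_k = 0 leaves the sequences avoiding k; \<sigma> closes the gap and \<delta>
  reopens it. The result does not depend on k, which is quasisymmetry.\<close>

lemma ins_seq_poly:
  assumes k: "1 \<le> k" "k \<le> n" and D: "D \<subseteq> {1..<m}"
  shows "ins k 0 (seq_poly n m D) = seq_poly (n - 1) m D"
proof -
  define \<sigma> where "\<sigma> x = (if x < k then x else x - 1)" for x :: nat
  define \<delta> where "\<delta> x = (if x < k then x else Suc x)" for x :: nat
  let ?m = "\<lambda>s. prod_list (map (\<lambda>x. Var (X x)) s)"
  have "ins k 0 (Var (X a)) = (if a = k then 0 else Var (X (\<sigma> a)))" for a
    by (simp add: \<sigma>_def)
  then have prod: "ins k 0 (?m s) = (if k \<in> set s then 0 else ?m (map \<sigma> s))" for s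
  proof (induction s)
    case Nil
    then show ?case by (simp add: ins_def)
  qed (auto simp del: ins_X)
  have "ins k 0 (seq_poly n m D) = (\<Sum>s\<in>seqs n m D. if k \<in> set s then 0 else ?m (map \<sigma> s))"
    by (simp add: seq_poly_def prod)
  also have "\<dots> = (\<Sum>s\<in>{s\<in>seqs n m D. k \<notin> set s}. ?m (map \<sigma> s))"
    by (simp add: sum.inter_filter finite_seqs if_not_P if_distrib cong: if_cong)
       (intro sum.cong, auto)
  also have "\<dots> = (\<Sum>s\<in>seqs (n - 1) m D. ?m s)"
  proof (rule sum.reindex_bij_witness[where i = "map \<delta>" and j = "map \<sigma>"])
    fix s assume s: "s \<in> {s \<in> seqs n m D. k \<notin> set s}"
    have "\<delta> (\<sigma> x) = x" if "x \<in> set s" for x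
    proof -
      have "x \<noteq> k" using that s by auto
      then show ?thesis by (auto simp: \<sigma>_def \<delta>_def)
    qed
    then show "map \<delta> (map \<sigma> s) = s" by (simp add: map_idI)
    show "map \<sigma> s \<in> seqs (n - 1) m D"
    proof (rule map_seqs[OF _ D])
      show "s \<in> seqs n m D" using s by simp
      have x: "1 \<le> x" "x \<le> n" "x \<noteq> k" if "x \<in> set s" for x
        using that s by (auto simp: seqs_def)
      show "\<sigma> ` set s \<subseteq> {1..n - 1}"
      proof
        fix y assume "y \<in> \<sigma> ` set s"
        then obtain x where "x \<in> set s" "y = \<sigma> x" by blast
        then show "y \<in> {1..n - 1}" using x[of x] k by (auto simp: \<sigma>_def)
      qed
      show "\<sigma> x < \<sigma> y" if "x \<in> set s" "y \<in> set s" "x < y" for x y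
        using that x[OF that(1)] x[OF that(2)] by (auto simp: \<sigma>_def)
    qed
  next
    fix s assume s: "s \<in> seqs (n - 1) m D"
    show "map \<sigma> (map \<delta> s) = s" by (auto simp: \<sigma>_def \<delta>_def intro!: map_idI)
    have "map \<delta> s \<in> seqs n m D"
    proof (rule map_seqs[OF s D])
      have "1 \<le> x \<and> x \<le> n - 1" if "x \<in> set s" for x
        using that s by (auto simp: seqs_def)
      then show "\<delta> ` set s \<subseteq> {1..n}"
        using k by (fastforce simp: \<delta>_def)
      show "\<delta> x < \<delta> y" if "x < y" for x y using that by (auto simp: \<delta>_def)
    qed
    then show "map \<delta> s \<in> {s \<in> seqs n m D. k \<notin> set s}" by (auto simp: \<delta>_def)
  qed simp
  finally show ?thesis by (simp add: seq_poly_def)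
qed

lemma E_seq_poly_zero:
  assumes "i \<ge> 1" "i \<noteq> n" "D \<subseteq> {1..<m}"
  shows "E i 0 (seq_poly n m D) = 0"
proof (cases "i < n")
  case True
  then show ?thesis
    using assms by (simp add: E_eq_0_iff seq_poly_Pos ins_seq_poly)
next
  case False
  then show ?thesis using assms by (intro E_low[OF _ _ seq_poly_Zt_xn]) auto
qed

text \<open>A sorted sequence containing n ends in n. Stripping that entry leaves its predecessor
  below n exactly when a strict increase is forced at m.\<close>

lemma seqs_last:
  assumes n: "n \<ge> 1" and D: "D \<subseteq> {1..m}"
  shows "{s\<in>seqs n (Suc m) D. n \<in> set s}
    = (\<lambda>s. s @ [n]) ` seqs (if m \<in> D then n - 1 else n) m (D - {m})" (is "?L = ?R")
proof (intro equalityI subsetI)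
  fix s assume s: "s \<in> ?L"
  then have len: "length s = Suc m" and sorted: "sorted s" and range: "set s \<subseteq> {1..n}"
    and desc: "\<And>j. j \<in> D \<Longrightarrow> s ! (j - 1) < s ! j" by (auto simp: seqs_def)
  obtain r x where r: "s = r @ [x]" using len by (cases s rule: rev_cases) auto
  have lr: "length r = m" using len r by simp
  have "x = n"
    using s range sorted by (auto simp: r sorted_append intro: antisym)
  have dr: "r ! (j - 1) < r ! j" if "j \<in> D - {m}" for j
  proof -
    have "j \<in> {1..m}" "j \<noteq> m" using that D by auto
    then have "j < m" "j - 1 < m" by auto
    then show ?thesis using desc[of j] that lr by (simp add: r nth_append)
  qed
  have "set r \<subseteq> {1..(if m \<in> D then n - 1 else n)}"
  proof (cases "m \<in> D")
    case True
    then have "m \<ge> 1" using D by auto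
    then have "r ! (m - 1) < n"
      using desc[OF True] lr \<open>x = n\<close> by (simp add: r nth_append)
    moreover have "y \<le> r ! (m - 1)" if y: "y \<in> set r" for y
    proof -
      obtain i where "i < m" "y = r ! i" using y lr by (auto simp: in_set_conv_nth)
      then show ?thesis
        using sorted lr sorted_nth_mono[of r i "m - 1"] by (simp add: r sorted_append)
    qed
    ultimately show ?thesis using range True r by fastforce
  qed (use range r in auto)
  then have "r \<in> seqs (if m \<in> D then n - 1 else n) m (D - {m})"
    using dr lr sorted by (auto simp: seqs_def r sorted_append)
  then show "s \<in> ?R" using r \<open>x = n\<close> by blast
next
  fix s assume "s \<in> ?R"
  then obtain r where r: "s = r @ [n]" "r \<in> seqs (if m \<in> D then n - 1 else n) m (D - {m})" by blast
  have lr: "length r = m" and sorted: "sorted r" and range: "set r \<subseteq> {1..(if m \<in> D then n - 1 else n)}"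
    and desc: "\<And>j. j \<in> D - {m} \<Longrightarrow> r ! (j - 1) < r ! j" using r(2) by (auto simp: seqs_def)
  have "{1..(if m \<in> D then n - 1 else n)} \<subseteq> {1..n}" by auto
  with range have rn: "set r \<subseteq> {1..n}" by (rule order_trans)
  have "s ! (j - 1) < s ! j" if j: "j \<in> D" for j
  proof (cases "j = m")
    case True
    then have "m \<ge> 1" "m \<in> D" using D j by auto
    then have "r ! (m - 1) \<in> set r" using lr by simp
    then have "r ! (m - 1) \<in> {1..n - 1}" using range \<open>m \<in> D\<close> by (auto dest: subsetD)
    then have "r ! (m - 1) < n" using n by auto
    then show ?thesis using True \<open>m \<ge> 1\<close> lr by (simp add: r(1) nth_append)
  next
    case False
    moreover have "j \<in> {1..m}" using D j by blast
    ultimately have "j < m" "j - 1 < m" by auto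
    then show ?thesis using desc[of j] False j lr by (simp add: r(1) nth_append)
  qed
  then show "s \<in> ?L" using lr sorted rn n by (auto simp: seqs_def r(1) sorted_append)
qed

text \<open>At parameter 0 the numerator is the sum over the sequences containing n; stripping the
  final n divides it by x_n.\<close>

lemma E_seq_poly:
  assumes n: "n \<ge> 1" and D: "D \<subseteq> {1..m}"
  shows "E n 0 (seq_poly n (Suc m) D) = seq_poly (if m \<in> D then n - 1 else n) m (D - {m})"
proof (rule E_eqI)
  let ?m = "\<lambda>s. prod_list (map (\<lambda>x. Var (X x)) s)"
  let ?S = "seqs (if m \<in> D then n - 1 else n) m (D - {m})"
  have "seqs (n - 1) (Suc m) D = seqs n (Suc m) D - {s\<in>seqs n (Suc m) D. n \<in> set s}"
  proof -
    have "set s \<subseteq> {1..n - 1} \<longleftrightarrow> set s \<subseteq> {1..n} \<and> n \<notin> set s" for s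
      using n by (force simp: subset_iff le_less)
    then show ?thesis by (auto simp: seqs_def)
  qed
  then have "seq_poly n (Suc m) D - seq_poly (n - 1) (Suc m) D
      = (\<Sum>s\<in>{s\<in>seqs n (Suc m) D. n \<in> set s}. ?m s)"
    unfolding seq_poly_def by (simp add: sum_diff finite_seqs)
  also have "\<dots> = (\<Sum>s\<in>?S. ?m (s @ [n]))"
    unfolding seqs_last[OF n D] by (subst sum.reindex) (auto simp: inj_on_def)
  also have "\<dots> = Var (X n) * seq_poly (if m \<in> D then n - 1 else n) m (D - {m})"
    by (simp add: seq_poly_def sum_distrib_left mult.commute)
  finally show "(Var (X n) - 0) * seq_poly (if m \<in> D then n - 1 else n) m (D - {m})
      = ins (Suc n) 0 (seq_poly n (Suc m) D) - ins n 0 (seq_poly n (Suc m) D)"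
    using n D by (simp add: ins_low[OF seq_poly_Zt_xn] ins_seq_poly atLeastLessThanSuc_atLeastAtMost)
qed simp

lemma xsub_seq_poly: "xsub (\<lambda>_. 0) (seq_poly n (Suc m) D) = 0"
  unfolding seq_poly_def xsub_simps
proof (intro sum.neutral ballI)
  fix s assume "s \<in> seqs n (Suc m) D"
  then have "length s = Suc m" by (simp add: seqs_def)
  then show "xsub (\<lambda>_. 0) (prod_list (map (\<lambda>x. Var (X x)) s)) = 0" by (cases s) auto
qed

text \<open>The right side does not mention x: lowering the last part keeps the descent set.\<close>

lemma psums_append: "psums (b @ [x]) = {sum_list (take k b) | k. 1 \<le> k \<and> k \<le> length b}"
  unfolding psums_def by (intro Collect_cong iff_exI) auto

lemma sum_list_take_le: "sum_list (take k b) \<le> sum_list b" for b :: "nat list"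
  by (metis append_take_drop_id le_add1 sum_list_append)

lemma psums_append_subset:
  assumes "\<forall>y\<in>set b. 0 < y"
  shows "psums (b @ [x]) \<subseteq> {1..sum_list b}"
proof
  fix j assume "j \<in> psums (b @ [x])"
  then obtain k where k: "j = sum_list (take k b)" "1 \<le> k" "k \<le> length b"
    unfolding psums_append by blast
  then obtain y b' where "b = y # b'" by (cases b) auto
  moreover obtain k' where "k = Suc k'" using k by (cases k) auto
  ultimately have "j \<ge> 1" using k assms by auto
  then show "j \<in> {1..sum_list b}" using k sum_list_take_le by auto
qed

text \<open>Positive parts make the partial sums strictly increasing, so the total is attained only
  by the full list.\<close>

lemma psums_append_diff:
  assumes "\<forall>y\<in>set b. 0 < y"
  shows "psums (b @ [x]) - {sum_list b} = psums b"
proof (intro equalityI subsetI)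
  fix j assume j: "j \<in> psums (b @ [x]) - {sum_list b}"
  then obtain k where k: "j = sum_list (take k b)" "1 \<le> k" "k \<le> length b"
    unfolding psums_append by blast
  moreover have "k \<noteq> length b" using j k by auto
  ultimately show "j \<in> psums b" by (auto simp: psums_def)
next
  fix j assume "j \<in> psums b"
  then obtain k where k: "j = sum_list (take k b)" "1 \<le> k" "k < length b"
    by (auto simp: psums_def)
  have "sum_list b = sum_list (take k b) + sum_list (drop k b)"
    by (metis append_take_drop_id sum_list_append)
  moreover have "sum_list (drop k b) \<ge> b ! k"
    using k(3) by (simp add: Cons_nth_drop_Suc[symmetric])
  moreover have "b ! k > 0" using assms k(3) by auto
  ultimately have "j \<noteq> sum_list b" using k(1) by linarith
  then show "j \<in> psums (b @ [x]) - {sum_list b}"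
    unfolding psums_append using k by auto
qed

lemma forest_of_comp_zero:
  assumes "\<forall>x\<in>set c. x = 0"
  shows "forest_of_comp c = empty_forest"
proof (rule forest_of_comp_eqI)
  fix i :: nat assume "i \<ge> 1"
  then show "code empty_forest i = (if i \<le> length c then c ! (i - 1) else 0)"
    using assms nth_mem[of "i - 1" c] by auto
qed simp

text \<open>For x = 1 the last entry becomes 0 and is cut off, since a 0 after positive entries
  would violate padding.\<close>

lemma fdel_forest_of_comp:
  assumes "padded_comp (Suc n) (c @ [x])" "x > 0"
  shows "fdel (forest_of_comp (c @ [x])) (Suc n)
    = forest_of_comp (if x = 1 then c else c @ [x - 1])"
proof (rule forest_of_comp_eqI[symmetric])
  have len: "length c = n" using assms by (simp add: padded_comp_def)
  have Q: "Suc n \<in> Qdes (forest_of_comp (c @ [x]))"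
    using assms len by (simp add: Qdes_forest_of_comp[OF assms(1)] nth_append)
  show "is_forest (fdel (forest_of_comp (c @ [x])) (Suc n))"
    by (rule is_forest_fdel[OF is_forest_of_comp])
  fix i :: nat assume i: "i \<ge> 1"
  have "i - 1 < n \<longleftrightarrow> i < Suc n" using i by auto
  then show "code (fdel (forest_of_comp (c @ [x])) (Suc n)) i
      = (if i \<le> length (if x = 1 then c else c @ [x - 1])
         then (if x = 1 then c else c @ [x - 1]) ! (i - 1) else 0)"
    using i len by (auto simp: code_fdel[OF Q] code_forest_of_comp nth_append)
qed

lemma padded_compD: "padded_comp n c \<Longrightarrow> i < j \<Longrightarrow> j < n \<Longrightarrow> 0 < c ! i \<Longrightarrow> 0 < c ! j"
  by (simp add: padded_comp_def)

lemma padded_comp_zero: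
  assumes "padded_comp (Suc n) (c @ [0])"
  shows "\<forall>y\<in>set (c @ [0]). y = 0"
proof
  fix y assume "y \<in> set (c @ [0])"
  then consider "y = 0" | i where "i < n" "y = (c @ [0]) ! i"
    using assms by (auto simp: padded_comp_def in_set_conv_nth nth_append)
  then show "y = 0"
  proof cases
    case 2
    have "(c @ [0]) ! n = 0" using assms by (simp add: padded_comp_def nth_append)
    then show ?thesis using padded_compD[OF assms 2(1) lessI] 2(2) by fastforce
  qed
qed

lemma padded_comp_decr:
  assumes "padded_comp (Suc n) (c @ [x])" "x > 0"
  shows "padded_comp (if x = 1 then n else Suc n) (if x = 1 then c else c @ [x - 1])"
proof -
  have len: "length c = n" using assms by (simp add: padded_comp_def)
  have pad: "0 < c ! j" if "i < j" "j < n" "0 < c ! i" for i j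
  proof -
    have "0 < (c @ [x]) ! j"
      using padded_compD[OF assms(1), of i j] that len by (simp add: nth_append)
    then show ?thesis using that len by (simp add: nth_append)
  qed
  have "0 < (c @ [x - 1]) ! j" if "x \<noteq> 1" "i < j" "j < Suc n" "0 < (c @ [x - 1]) ! i" for i j
    using that pad[of i j] len assms(2) by (cases "j = n") (auto simp: nth_append)
  then show ?thesis using pad len by (auto simp: padded_comp_def)
qed

text \<open>Both sides satisfy the same recursion under \<open>E\<^sub>n\<close> at \<open>t = 0\<close>, which lowers the last part
  of the composition (dropping it, together with \<open>x\<^sub>n\<close>, once it becomes zero).\<close>
lemma dfps_zero_fqs:
  assumes "padded_comp n c"
  shows "dfps (\<lambda>_. 0) (forest_of_comp c) = fqs n c"
  using assms
proof (induction "sum_list c" arbitrary: n c rule: less_induct)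
  case less
  let ?p = "filter (\<lambda>k. 0 < k) :: nat list \<Rightarrow> nat list"
  define s :: "nat \<Rightarrow> mpoly" where "s = (\<lambda>_. 0)"
  have s: "param_seq s" by (simp add: s_def param_seq_def)
  show ?case
  proof (cases "\<forall>x\<in>set c. x = 0")
    case True
    then have "?p c = []" by (simp add: filter_empty_conv)
    then show ?thesis
      using dfps_empty[OF s] True by (simp add: s_def fqs_seq_poly psums_def seq_poly_0 forest_of_comp_zero)
  next
    case False
    then obtain c0 x where c: "c = c0 @ [x]" by (cases c rule: rev_cases) auto
    obtain n0 where n: "n = Suc n0" "length c0 = n0"
      using less.prems c by (auto simp: padded_comp_def)
    have x: "x > 0"
    proof (rule ccontr)
      assume "\<not> x > 0"
      then show False using padded_comp_zero[of n0 c0] less.prems False by (simp add: c n)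
    qed
    define c' where "c' = (if x = 1 then c0 else c0 @ [x - 1])"
    define n' where "n' = (if x = 1 then n0 else n)"
    define b where "b = ?p c0"
    have b: "\<forall>y\<in>set b. 0 < y" by (simp add: b_def)
    define m where "m = sum_list b + (x - 1)"
    let ?F = "forest_of_comp c" and ?D = "psums (b @ [x])"
    have fqs: "fqs n c = seq_poly n (Suc m) ?D"
      using x by (simp add: fqs_seq_poly c b_def m_def)
    have D: "?D \<subseteq> {1..m}" using psums_append_subset[OF b, of x] by (auto simp: m_def)
    have fqs': "E n 0 (fqs n c) = fqs n' c'"
    proof (cases "x = 1")
      case True
      have "seq_poly (if m \<in> ?D then n - 1 else n) m (?D - {m}) = seq_poly n0 m (psums b)"
      \<comment> \<open>With no remaining parts m = 0, and both polynomials are 1 although their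
        numbers of variables differ.\<close>
      proof (cases "b = []")
        case True
        then show ?thesis
          using \<open>x = 1\<close> by (simp add: m_def psums_def seq_poly_0)
      next
        case False
        then have "m \<in> ?D"
          using \<open>x = 1\<close> unfolding psums_append
          by (auto simp: m_def Suc_le_eq intro!: exI[of _ "length b"])
        then show ?thesis using psums_append_diff[OF b, of x] True n by (simp add: m_def)
      qed
      also have "\<dots> = fqs n' c'"
        using True by (simp add: fqs_seq_poly n'_def c'_def b_def m_def)
      finally show ?thesis unfolding fqs using E_seq_poly[OF _ D, of n] n by simp
    next
      case False
      \<comment> \<open>For x > 1 the removed entry is not the only one of its block, so no strict
        increase precedes it and x_n remains available.\<close>
      then have "m \<notin> {1..sum_list b}" using x by (auto simp: m_def)
      then have "m \<notin> ?D" using psums_append_subset[OF b, of x] by blast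
      moreover have "psums (b @ [x - 1]) = ?D" by (simp add: psums_append)
      moreover have "fqs n' c' = seq_poly n m (psums (b @ [x - 1]))"
        using False x by (simp add: fqs_seq_poly n'_def c'_def b_def m_def)
      ultimately show ?thesis
        unfolding fqs using E_seq_poly[OF _ D, of n] n by simp
    qed
    have Q: "i \<in> Qdes ?F \<longleftrightarrow> i = n" for i
      using Qdes_forest_of_comp[OF less.prems, of i] x n by (auto simp: c nth_append)
    have IH: "dfps s (forest_of_comp c') = fqs n' c'"
      unfolding s_def
    proof (rule less.hyps)
      show "sum_list c' < sum_list c" using x by (auto simp: c'_def c)
      show "padded_comp n' c'"
        using padded_comp_decr[of n0 c0 x] less.prems x unfolding c'_def n'_def c n by blast
    qed
    have EF: "E i (s i) (dfps s ?F) = (if i = n then fqs n' c' else 0)" if "i \<ge> 1" for i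
    proof -
      have "fdel ?F n = forest_of_comp c'"
        using fdel_forest_of_comp[of n0 c0 x] less.prems x by (simp add: c'_def c n)
      moreover have "skip i s = s" by (simp add: s_def skip_def fun_eq_iff)
      ultimately show ?thesis
        using E_dfps[OF is_forest_of_comp[of c] s that] Q IH by auto
    qed
    have Efqs: "E i (s i) (fqs n c) = (if i = n then fqs n' c' else 0)" if "i \<ge> 1" for i
      using fqs' E_seq_poly_zero[OF that, of n ?D "Suc m"] D
      by (auto simp: s_def fqs atLeastLessThanSuc_atLeastAtMost)
    have P: "dfps s ?F \<in> Pos" "fqs n c \<in> Pos"
      using dfps_Pos[OF is_forest_of_comp s] seq_poly_Pos fqs by auto
    have "dfps s ?F - fqs n c = 0"
    proof (rule zero_if_E_xsub_zero[OF _ s])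
      show "dfps s ?F - fqs n c \<in> Pos" using P by blast
      fix i :: nat assume i: "i \<ge> 1"
      show "E i (s i) (dfps s ?F - fqs n c) = 0"
        using EF[OF i] Efqs[OF i] P by (simp add: E_diff[OF param_seqD[OF s i] i])
    next
      \<comment> \<open>At x = 0 both sides vanish: the forest is nonempty and the sequences have
        positive length.\<close>
      have "?F \<noteq> empty_forest" using Q[of n] by auto
      then show "xsub s (dfps s ?F - fqs n c) = 0"
        using xsub_dfps[OF is_forest_of_comp s] by (simp add: fqs) (simp add: s_def xsub_seq_poly)
    qed
    then show ?thesis by (simp add: s_def)
  qed
qed

theorem theorem4p12:
  fixes n :: nat
  assumes "n \<ge> 1"
  shows "(\<forall>c. padded_comp n c \<longrightarrow> eval_t0 (dfqs c) = fqs n c) \<and>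
         dfp ` Zigzag n = {dfqs c | c. padded_comp n c} \<and>
         Zt_basis (dfp ` Zigzag n) (EQSym n)"
proof (intro conjI allI impI)
  fix c assume "padded_comp n c"
  moreover have "eval_t0 = tsub (\<lambda>_. 0)"
    by (simp add: eval_t0_def tsub_def)
  ultimately show "eval_t0 (dfqs c) = fqs n c"
    using dfps_zero_fqs by (simp add: dfqs_def dfps_def)
next
  show "dfp ` Zigzag n = {dfqs c | c. padded_comp n c}"
    by (auto simp: Zigzag_eq dfqs_def)
next
  show "Zt_basis (dfp ` Zigzag n) (EQSym n)"
    by (rule Zigzag_basis)
qed

end
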